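(* For the thermometer coding, as $n\to\infty$, $$\frac{I_{\mathrm{lsb}}}{\sigma_u\sqrt{n}}\,\mathrm{INL}_{\max}\longrightarrow X$$ in distribution, in $L^1$ and $L^2$, where the limit $X$ is characterized by $$X=\max_{t\in[0,1]}|B_t|$$ for a Brownian bridge $\{B_s\}_{s\in[0,1]}$, and $$\mathbb{E}[X]=\frac{\sqrt{2\pi}}{2}\ln 2\approx 0.86875,\qquad \operatorname{Var}(X)=\frac{\pi^2}{12}-\frac{\pi}{2}(\ln 2)^2\approx 0.0677732,$$ and $$\mathbb{P}(X\le x)=1+2\sum_{k=1}^\infty(-1)^k e^{-2k^2x^2},\qquad x>0.$$
   Context: Let $\bar I_u>0$ and $\sigma_u>0$ be constants, and let $I_{u_1},I_{u_2},\dots$ be i.i.d. normal random variables with mean $\bar I_u$ and variance $\sigma_u^2$ (the unit currents of a digital-to-analog converter). For $n\ge1$ put $I_{\mathrm{lsb}}:=\frac1n\sum_{j=1}^n I_{u_j}$. In the thermometer coding the output currents are $I_{\mathrm{out}_k}:=\sum_{j=1}^k I_{u_j}$ for $k=0,\dots,n$. The integrated non-linearity is $\mathrm{INL}_k:=\frac{I_{\mathrm{out}_k}-k\,I_{\mathrm{lsb}}}{I_{\mathrm{lsb}}}$ for $k=0,\dots,n$ (so $\mathrm{INL}_0=\mathrm{INL}_n=0$), and $\mathrm{INL}_{\max}:=\max_{k=0,\dots,n}|\mathrm{INL}_k|$. A Brownian bridge $\{B_s\}_{s\in[0,1]}$ is a process with the law of $\{W_s-sW_1\}_{s\in[0,1]}$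 for a standard Wiener process $\{W_s\}_{s\in[0,1]}$; equivalently, it is a standard Wiener process on $[0,1]$ conditioned to equal $0$ at time $1$.
   Formalization: Convergence in L^1 and L^2, impossible for one fixed sequence of currents, is stated for a suitable realisation: for each n, i.i.d. normal currents on an extension of the bridge's probability space. The mean is 0.86873..., so 0.86875 is asserted only within 0.00005. *)

theory Defs
  imports "HOL-Probability.Probability"
begin

text \<open>I.i.d. normal unit currents; the index set \<open>J\<close> is \<open>{1..}\<close> for a whole sequence and
  \<open>{1..n}\<close> for the currents of a single converter.\<close>

definition unit_currents ::
  "'a measure \<Rightarrow> (nat \<Rightarrow> 'a \<Rightarrow> real) \<Rightarrow> real \<Rightarrow> real \<Rightarrow> nat set \<Rightarrow> bool" where
  "unit_currents M I \<mu> \<sigma> J \<longleftrightarrow>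
     prob_space M \<and>
     prob_space.indep_vars M (\<lambda>_. borel) I J \<and>
     (\<forall>j\<in>J. distributed M lborel (I j) (normal_density \<mu> \<sigma>))"

definition I_lsb :: "(nat \<Rightarrow> 'a \<Rightarrow> real) \<Rightarrow> nat \<Rightarrow> 'a \<Rightarrow> real" where
  "I_lsb I n \<omega> = (1 / real n) * (\<Sum>j=1..n. I j \<omega>)"

definition I_out :: "(nat \<Rightarrow> 'a \<Rightarrow> real) \<Rightarrow> nat \<Rightarrow> 'a \<Rightarrow> real" where
  "I_out I k \<omega> = (\<Sum>j=1..k. I j \<omega>)"

text \<open>The quotient is \<open>0\<close> where \<open>I_lsb\<close> vanishes, which is a null event.\<close>

definition INL :: "(nat \<Rightarrow> 'a \<Rightarrow> real) \<Rightarrow> nat \<Rightarrow> nat \<Rightarrow> 'a \<Rightarrow> real" where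
  "INL I n k \<omega> = (I_out I k \<omega> - real k * I_lsb I n \<omega>) / I_lsb I n \<omega>"

definition INL_max :: "(nat \<Rightarrow> 'a \<Rightarrow> real) \<Rightarrow> nat \<Rightarrow> 'a \<Rightarrow> real" where
  "INL_max I n \<omega> = Max ((\<lambda>k. \<bar>INL I n k \<omega>\<bar>) ` {0..n})"

definition scaled_INL_max :: "real \<Rightarrow> (nat \<Rightarrow> 'a \<Rightarrow> real) \<Rightarrow> nat \<Rightarrow> 'a \<Rightarrow> real" where
  "scaled_INL_max \<sigma> I n \<omega> = I_lsb I n \<omega> / (\<sigma> * sqrt (real n)) * INL_max I n \<omega>"

definition wiener_process :: "'a measure \<Rightarrow> (real \<Rightarrow> 'a \<Rightarrow> real) \<Rightarrow> bool" where
  "wiener_process P W \<longleftrightarrow>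
     prob_space P \<and>
     (\<forall>t\<in>{0..1}. W t \<in> borel_measurable P) \<and>
     (\<forall>\<omega>\<in>space P. continuous_on {0..1} (\<lambda>t. W t \<omega>)) \<and>
     (AE \<omega> in P. W 0 \<omega> = 0) \<and>
     (\<forall>s t. 0 \<le> s \<and> s < t \<and> t \<le> 1 \<longrightarrow>
        distributed P lborel (\<lambda>\<omega>. W t \<omega> - W s \<omega>) (normal_density 0 (sqrt (t - s)))) \<and>
     (\<forall>m \<tau>. (\<forall>i\<le>m. \<tau> i \<in> {0..1}) \<and> (\<forall>i<m. \<tau> i < \<tau> (Suc i)) \<longrightarrow>
        prob_space.indep_vars P (\<lambda>_. borel)
          (\<lambda>i \<omega>. W (\<tau> (Suc i)) \<omega> - W (\<tau> i) \<omega>) {..<m::nat})"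

definition path_law :: "'a measure \<Rightarrow> (real \<Rightarrow> 'a \<Rightarrow> real) \<Rightarrow> (real \<Rightarrow> real) measure" where
  "path_law P Y = distr P (\<Pi>\<^sub>M t\<in>{0..1}. borel) (\<lambda>\<omega>. \<lambda>t\<in>{0..1}. Y t \<omega>)"

text \<open>A Brownian bridge is a continuous process with the law of \<open>W\<^sub>s - s W\<^sub>1\<close>.  The Wiener process
  may live on a different probability space than \<open>B\<close>; taking the type \<open>real \<Rightarrow> real\<close> for its sample
  points loses nothing, because every Wiener process has a version on its path space.\<close>

definition brownian_bridge :: "'b measure \<Rightarrow> (real \<Rightarrow> 'b \<Rightarrow> real) \<Rightarrow> bool" where
  "brownian_bridge N B \<longleftrightarrow>
     prob_space N \<and>
     (\<forall>t\<in>{0..1}. B t \<in> borel_measurable N) \<and>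
     (\<forall>\<omega>\<in>space N. continuous_on {0..1} (\<lambda>t. B t \<omega>)) \<and>
     (\<exists>(P :: (real \<Rightarrow> real) measure) W.
        wiener_process P W \<and>
        path_law N B = path_law P (\<lambda>s \<omega>. W s \<omega> - s * W 1 \<omega>))"

text \<open>The supremum is a maximum, the paths being continuous on a compact interval.\<close>

definition max_abs_path :: "(real \<Rightarrow> 'b \<Rightarrow> real) \<Rightarrow> 'b \<Rightarrow> real" where
  "max_abs_path B \<omega> = (SUP t\<in>{0..1}. \<bar>B t \<omega>\<bar>)"

definition tendsto_Lp ::
  "'a measure \<Rightarrow> nat \<Rightarrow> (nat \<Rightarrow> 'a \<Rightarrow> real) \<Rightarrow> ('a \<Rightarrow> real) \<Rightarrow> bool" where
  "tendsto_Lp P p Z X \<longleftrightarrow>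
     (\<forall>n\<ge>1. Z n \<in> borel_measurable P \<and> integrable P (\<lambda>\<omega>. \<bar>Z n \<omega>\<bar> ^ p)) \<and>
     X \<in> borel_measurable P \<and> integrable P (\<lambda>\<omega>. \<bar>X \<omega>\<bar> ^ p) \<and>
     (\<lambda>n. \<integral>\<omega>. \<bar>Z n \<omega> - X \<omega>\<bar> ^ p \<partial>P) \<longlonglongrightarrow> 0"

text \<open>\<open>L\<^sup>p\<close> convergence of the scaled maximal INL to a random variable \<open>X\<close> on \<open>N\<close>.  For one fixed
  i.i.d. sequence of currents no such convergence is possible: the scaled maxima are asymptotically
  independent of any finite number of the currents, so that a limit in probability would be constant.
  Hence the convergence is one for a suitable realisation: on an extension \<open>P\<close> of the probability
  space \<open>N\<close> there are, for each \<open>n\<close>, i.i.d. normal currents \<open>J n 1, \<dots>, J n n\<close> with the prescribed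
  parameters, and the expressions formed from them converge to \<open>X\<close>.  The same realisation has to
  serve all exponents \<open>p \<in> S\<close>.\<close>

definition scaled_INL_max_tendsto_Lp ::
  "real \<Rightarrow> real \<Rightarrow> nat set \<Rightarrow> 'b measure \<Rightarrow> ('b \<Rightarrow> real) \<Rightarrow> bool" where
  "scaled_INL_max_tendsto_Lp \<mu> \<sigma> S N X \<longleftrightarrow>
     (\<exists>(P :: ('b \<times> real) measure) J.
        prob_space P \<and> fst \<in> measurable P N \<and> distr P N fst = N \<and>
        (\<forall>n\<ge>1. unit_currents P (J n) \<mu> \<sigma> {1..n}) \<and>
        (\<forall>p\<in>S. tendsto_Lp P p (\<lambda>n. scaled_INL_max \<sigma> (J n) n) (\<lambda>\<omega>. X (fst \<omega>))))"

end

theory Submission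
  imports Defs
begin

text \<open>
  Write \<open>X\<close> for the maximum of \<open>\<bar>B\<bar>\<close>, and let \<open>Z\<close> be a standard normal variable independent of the
  bridge \<open>B\<close>.  Everything rests on the process \<open>W\<^sub>t = B\<^sub>t + t Z\<close>: its increments over a grid of mesh
  \<open>1/n\<close> are i.i.d. normal (\<open>bridge_with_drift_law\<close>).  The reason is rotation invariance: the increments
  of \<open>B\<close> are those of a Wiener process with their mean removed, and adding \<open>Z\<close> puts an independent mean
  of the right variance back (\<open>std_normal_replace_mean\<close>).

  Convergence.  Rescaled increments of \<open>W\<close> can serve as the unit currents.  For them the scaled maximal
  INL equals the maximum of \<open>\<bar>B\<bar>\<close> over the grid points \<open>k/n\<close>, up to the sign of \<open>I_lsb = \<mu> + \<sigma> Z / sqrt n\<close>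
  (\<open>scaled_INL_max_currents\<close>).  As \<open>\<mu> > 0\<close> and the paths are continuous, it converges to \<open>X\<close> almost
  surely, and it is dominated by \<open>X\<close>; so it converges in \<open>L\<^sup>1\<close> and \<open>L\<^sup>2\<close> as soon as \<open>X\<close> is square
  integrable.  The law of the scaled maximum depends only on the law of the currents, which gives the
  convergence in distribution for an arbitrary i.i.d. sequence.

  Distribution function.  By the method of images, the alternating sum \<open>v\<close> of heat kernels centred at
  the multiples of \<open>2x\<close> solves the heat equation and vanishes at \<open>\<plusminus>x\<close>.  Hence \<open>v\<close> evaluated along the
  random walk \<open>W\<^sub>0, W\<^sub>1\<^sub>/\<^sub>n, \<dots>\<close> with time reversed is a martingale, which is almost zero when the walk
  leaves \<open>[-x, x]\<close> (\<open>random_walk_barrier\<close>).  With \<open>n \<rightarrow> \<infinity>\<close> this computes the expectation of a narrow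
  Gaussian in \<open>W\<^sub>1 = Z\<close> on the event that \<open>\<bar>W\<bar>\<close> stays below \<open>x\<close> (\<open>barrier_estimate\<close>).  A narrow Gaussian
  in \<open>Z\<close> forces \<open>Z\<close> to be near \<open>0\<close>, where \<open>W\<close> is near \<open>B\<close>, and \<open>Z\<close> is independent of \<open>B\<close>; so the law of
  \<open>X\<close> is squeezed between two expressions with the same limit (\<open>sandwich\<close>, \<open>kolmogorov_cdf\<close>).

  Moments.  They follow from the tail of the distribution function by Fubini's theorem
  (\<open>kolmogorov_moments\<close>).  The terms of the tail integrate to multiples of \<open>(-1)\<^sup>k/k\<close> for the mean and
  of \<open>(-1)\<^sup>k/k\<^sup>2\<close> for the second moment, whence \<open>ln 2\<close> and \<open>\<pi>\<^sup>2/12\<close>.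
\<close>

section \<open>Numerical values\<close>

lemma kolmogorov_mean_numeric: "\<bar>sqrt (2 * pi) / 2 * ln 2 - 0.86875\<bar> < (0.00005::real)"
proof -
  have l: "ln 2 \<ge> (0.6931471::real)" "ln 2 \<le> (0.6931472::real)"
    using ln_approx_bounds[of "2::real" 8] by (auto simp: eval_nat_numeral)
  have s: "2.506628 \<le> sqrt (2*pi)" "sqrt (2*pi) \<le> 2.50663"
    using pi_approx by (intro real_le_rsqrt real_le_lsqrt; simp add: power2_eq_square)+
  have "2.506628 * 0.6931471 \<le> sqrt (2*pi) * ln 2" 
    by (intro mult_mono l s) auto
  moreover have "sqrt (2*pi) * ln 2 \<le> 2.50663 * (0.6931472::real)" 
    by (intro mult_mono l s) auto
  moreover have "sqrt (2*pi) / 2 * ln 2 = sqrt (2*pi) * ln 2 / 2" by simp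
  ultimately show ?thesis unfolding abs_less_iff by (simp add: field_simps)
qed

lemma kolmogorov_variance_numeric:
  "\<bar>pi\<^sup>2 / 12 - pi / 2 * (ln 2)\<^sup>2 - 0.0677732\<bar> < (0.00000005::real)"
proof -
  \<comment> \<open>Nine terms of the series in powers of \<open>1/3\<close> determine \<open>ln 2\<close> up to \<open>10\<^sup>-\<^sup>9\<close>.\<close>
  have l: "ln 2 \<ge> (0.69314718::real)" "ln 2 \<le> (0.69314719::real)"
    using ln_approx_bounds[of "2::real" 9] by (auto simp: eval_nat_numeral)
  have l2: "0.69314718^2 \<le> (ln (2::real))\<^sup>2" "(ln (2::real))\<^sup>2 \<le> 0.69314719^2"
    using l by (intro power_mono; simp)+
  have p2: "3.141592653588^2 \<le> pi^2" "pi^2 \<le> 3.1415926535899^2"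
    using pi_approx by (intro power_mono; simp)+
  have "3.141592653588 * 0.69314718^2 \<le> pi * (ln 2)^2" 
    using pi_approx by (intro mult_mono l2) auto
  moreover have "pi * (ln 2)^2 \<le> 3.1415926535899 * (0.69314719::real)^2" 
    using pi_approx by (intro mult_mono l2) auto
  ultimately show ?thesis using p2 unfolding abs_less_iff by (auto simp: power2_eq_square)
qed

section \<open>The alternating theta series and its moments\<close>

text \<open>Splitting off the first term leaves minus an alternating sum that starts at \<open>a 1\<close>; so the sum lies between \<open>a 0 - a 1\<close> and \<open>a 0\<close>.\<close>

lemma alternating_sum_bounds:
  fixes a :: "nat \<Rightarrow> real"
  assumes "decseq a" "\<And>k. 0 \<le> a k"
  shows "0 \<le> (\<Sum>k<n. (-1)^k * a k) \<and> (\<Sum>k<n. (-1)^k * a k) \<le> a 0"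
  using assms
proof (induction n arbitrary: a)
  case (Suc n)
  have "0 \<le> (\<Sum>k<n. (-1)^k * a (Suc k)) \<and> (\<Sum>k<n. (-1)^k * a (Suc k)) \<le> a (Suc 0)"
    using Suc.IH[of "\<lambda>k. a (Suc k)"] Suc.prems by (auto simp: decseq_def)
  moreover have "a (Suc 0) \<le> a 0" using Suc.prems by (auto simp: decseq_def)
  moreover have "(\<Sum>k<Suc n. (-1)^k * a k) = a 0 - (\<Sum>k<n. (-1)^k * a (Suc k))"
    by (subst sum.lessThan_Suc_shift) (simp add: sum_negf)
  ultimately show ?case by auto
qed simp

lemma theta_term_bound:
  "\<bar>(-1) ^ Suc k * exp (- 2 * (real (Suc k))\<^sup>2 * x\<^sup>2)\<bar> \<le> exp (- 2 * x\<^sup>2) ^ k"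
proof -
  have "real k \<le> (real (Suc k))\<^sup>2" by (auto simp: power2_eq_square algebra_simps)
  hence "real k * (2 * x\<^sup>2) \<le> (real (Suc k))\<^sup>2 * (2 * x\<^sup>2)" by (intro mult_right_mono) auto
  thus ?thesis by (simp add: abs_mult exp_of_nat_mult[symmetric] algebra_simps)
qed

lemma theta_summable:
  assumes "x > 0"
  shows "summable (\<lambda>k. (-1) ^ Suc k * exp (- 2 * (real (Suc k))\<^sup>2 * x\<^sup>2))"
proof (rule summable_comparison_test')
  show "summable (\<lambda>k. exp (- 2 * x\<^sup>2) ^ k)" using assms by (intro summable_geometric) simp
  show "norm ((-1) ^ Suc k * exp (- 2 * (real (Suc k))\<^sup>2 * x\<^sup>2)) \<le> exp (- 2 * x\<^sup>2) ^ k" if "k \<ge> 0" for k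
    using theta_term_bound[of k x] by simp
qed

text \<open>On a half-line that stays away from \<open>0\<close> the series is dominated by a geometric one.\<close>

lemma theta_isCont:
  assumes "x > 0"
  shows "isCont (\<lambda>x. \<Sum>k. (-1) ^ Suc k * exp (- 2 * (real (Suc k))\<^sup>2 * x\<^sup>2)) x"
proof -
  have "uniform_limit {x/2<..} (\<lambda>n x. \<Sum>k<n. (-1) ^ Suc k * exp (- 2 * (real (Suc k))\<^sup>2 * x\<^sup>2))
     (\<lambda>x. \<Sum>k. (-1) ^ Suc k * exp (- 2 * (real (Suc k))\<^sup>2 * x\<^sup>2)) sequentially"
  proof (rule Weierstrass_m_test)
    show "summable (\<lambda>k. exp (- 2 * (x/2)\<^sup>2) ^ k)" using assms by (intro summable_geometric) simp
    fix k y assume "y \<in> {x/2<..}"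
    hence "(x/2)\<^sup>2 \<le> y\<^sup>2" using assms by (intro power_mono) auto
    hence "exp (- 2 * y\<^sup>2) ^ k \<le> exp (- 2 * (x/2)\<^sup>2) ^ k" by (intro power_mono) auto
    thus "norm ((-1) ^ Suc k * exp (- 2 * (real (Suc k))\<^sup>2 * y\<^sup>2)) \<le> exp (- 2 * (x/2)\<^sup>2) ^ k"
      using theta_term_bound[of k y] by simp
  qed
  hence "continuous_on {x/2<..} (\<lambda>x. \<Sum>k. (-1) ^ Suc k * exp (- 2 * (real (Suc k))\<^sup>2 * x\<^sup>2))"
    by (rule uniform_limit_theorem[rotated]) (auto intro!: always_eventually continuous_intros)
  thus ?thesis using assms by (simp add: continuous_on_eq_continuous_at)
qed

lemma gaussian_half_moments:
  assumes "c > 0"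
  shows "has_bochner_integral lborel (\<lambda>t. indicator {0<..} t * exp (- (c * t)\<^sup>2)) (sqrt pi / (2 * c))" (is ?A)
    and "has_bochner_integral lborel (\<lambda>t. indicator {0<..} t * (exp (- (c * t)\<^sup>2) * t)) (1 / (2 * c\<^sup>2))" (is ?B)
proof -
  have scale: "has_bochner_integral lborel (\<lambda>t. f (0 + c * t)) (I / c)" 
    if "has_bochner_integral lborel f I" for f :: "real \<Rightarrow> real" and I
    using that lborel_integral_real_affine[of c f 0] lborel_integrable_real_affine_iff[of c f 0] assms
    by (auto simp: has_bochner_integral_iff field_simps)
  have ae: "AE t in lborel. t \<noteq> (0::real)" by (rule AE_lborel_singleton)
  have "has_bochner_integral lborel (\<lambda>t. indicator {0..} (0 + c * t) *\<^sub>R exp (- (0 + c * t)\<^sup>2)) (sqrt pi / 2 / c)"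
    by (rule scale[OF gaussian_moment_0])
  also have "?this \<longleftrightarrow> has_bochner_integral lborel (\<lambda>t. indicator {0<..} t * exp (- (c * t)\<^sup>2)) (sqrt pi / 2 / c)"
    by (rule has_bochner_integral_cong_AE, measurable)
      (use assms ae in \<open>auto simp: zero_le_mult_iff split: split_indicator elim!: eventually_mono\<close>)
  finally show ?A by simp
  have "has_bochner_integral lborel (\<lambda>t. indicator {0..} (0 + c * t) *\<^sub>R (exp (- (0 + c * t)\<^sup>2) * (0 + c * t))) (1 / 2 / c)"
    by (rule scale[OF gaussian_moment_1])
  also have "?this \<longleftrightarrow> has_bochner_integral lborel (\<lambda>t. indicator {0<..} t * (exp (- (c * t)\<^sup>2) * t) * c) (1 / 2 / c)"
    by (rule has_bochner_integral_cong_AE, measurable)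
      (use assms ae in \<open>auto simp: zero_le_mult_iff split: split_indicator elim!: eventually_mono\<close>)
  finally have "has_bochner_integral lborel (\<lambda>t. indicator {0<..} t * (exp (- (c * t)\<^sup>2) * t) * c / c) (1 / 2 / c / c)"
    by (rule has_bochner_integral_divide_zero)
  thus ?B using assms by (simp add: power2_eq_square mult.assoc)
qed

text \<open>Fubini applied to \<open>y\<^sup>p = \<integral>\<^sub>0\<^sup>y p t\<^sup>p\<^sup>-\<^sup>1 dt\<close>, which expresses a moment through the tail.  The exponent is \<open>p = Suc m\<close>, so that no subtraction of naturals appears.\<close>

lemma nn_integral_power_layer_cake:
  fixes X :: "'a \<Rightarrow> real"
  assumes "sigma_finite_measure M" and X[measurable]: "X \<in> borel_measurable M" and pos: "\<And>\<omega>. \<omega> \<in> space M \<Longrightarrow> 0 \<le> X \<omega>"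
  shows "(\<integral>\<^sup>+\<omega>. ennreal (X \<omega> ^ Suc m) \<partial>M) =
    (\<integral>\<^sup>+t. ennreal (indicator {0<..} t * (real (Suc m) * t ^ m)) * emeasure M {\<omega> \<in> space M. t < X \<omega>} \<partial>lborel)"
proof -
  interpret sigma_finite_measure M by fact
  interpret pair_sigma_finite M lborel ..
  have "ennreal (X \<omega> ^ Suc m) = (\<integral>\<^sup>+t. ennreal (indicator {0<..} t * (real (Suc m) * t ^ m)) * indicator {t. t < X \<omega>} t \<partial>lborel)"
    if "\<omega> \<in> space M" for \<omega>
  proof -
    have "(\<integral>\<^sup>+t. ennreal (real (Suc m) * t ^ m) * indicator {0..X \<omega>} t \<partial>lborel) = ennreal (X \<omega> ^ Suc m - 0 ^ Suc m)"
      using pos[OF that] DERIV_pow[of "Suc m"] by (intro nn_integral_FTC_Icc) (simp_all del: power_Suc of_nat_Suc)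
    moreover have "AE t in lborel. t \<noteq> (0::real)" "AE t in lborel. t \<noteq> X \<omega>" by (rule AE_lborel_singleton)+
    hence "(\<integral>\<^sup>+t. ennreal (real (Suc m) * t ^ m) * indicator {0..X \<omega>} t \<partial>lborel) = 
       (\<integral>\<^sup>+t. ennreal (indicator {0<..} t * (real (Suc m) * t ^ m)) * indicator {t. t < X \<omega>} t \<partial>lborel)"
      by (intro nn_integral_cong_AE, eventually_elim) (auto split: split_indicator)
    ultimately show ?thesis by simp
  qed
  hence "(\<integral>\<^sup>+\<omega>. ennreal (X \<omega> ^ Suc m) \<partial>M) = 
    (\<integral>\<^sup>+\<omega>. (\<integral>\<^sup>+t. ennreal (indicator {0<..} t * (real (Suc m) * t ^ m)) * indicator {t. t < X \<omega>} t \<partial>lborel) \<partial>M)"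
    by (intro nn_integral_cong) 
  also have "\<dots> = (\<integral>\<^sup>+t. (\<integral>\<^sup>+\<omega>. ennreal (indicator {0<..} t * (real (Suc m) * t ^ m)) * indicator {t. t < X \<omega>} t \<partial>M) \<partial>lborel)"
    by (rule Fubini'[symmetric]) measurable
  also have "\<dots> = (\<integral>\<^sup>+t. ennreal (indicator {0<..} t * (real (Suc m) * t ^ m)) * emeasure M {\<omega> \<in> space M. t < X \<omega>} \<partial>lborel)"
  proof (rule nn_integral_cong)
    fix t :: real
    have "(\<integral>\<^sup>+\<omega>. ennreal (indicator {0<..} t * (real (Suc m) * t ^ m)) * indicator {t. t < X \<omega>} t \<partial>M)
      = (\<integral>\<^sup>+\<omega>. ennreal (indicator {0<..} t * (real (Suc m) * t ^ m)) * indicator {\<omega> \<in> space M. t < X \<omega>} \<omega> \<partial>M)"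
      by (intro nn_integral_cong) (auto split: split_indicator)
    thus "(\<integral>\<^sup>+\<omega>. ennreal (indicator {0<..} t * (real (Suc m) * t ^ m)) * indicator {t. t < X \<omega>} t \<partial>M)
     = ennreal (indicator {0<..} t * (real (Suc m) * t ^ m)) * emeasure M {\<omega> \<in> space M. t < X \<omega>}"
      by (simp add: nn_integral_cmult_indicator)
  qed
  finally show ?thesis .
qed

text \<open>The series of the moments may converge only conditionally (for \<open>m = 0\<close> it is the alternating harmonic
  series), so the termwise integration cannot rest on absolute convergence.  Instead, the partial sums of the
  alternating series are dominated by its first term.\<close>

lemma theta_tail_moment:
  fixes T :: "real \<Rightarrow> real"
  assumes [measurable]: "T \<in> borel_measurable borel"
    and T: "\<And>t. t > 0 \<Longrightarrow> (\<lambda>k. 2 * ((-1) ^ k * exp (- (sqrt 2 * real (Suc k) * t)\<^sup>2))) sums T t"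
    and I: "\<And>k. has_bochner_integral lborel
      (\<lambda>t. indicator {0<..} t * (exp (- (sqrt 2 * real (Suc k) * t)\<^sup>2) * t ^ m)) (I k)"
    and L: "(\<lambda>k. 2 * ((-1) ^ k * I k)) sums L"
  shows "has_bochner_integral lborel (\<lambda>t. indicator {0<..} t * (t ^ m * T t)) L"
proof -
  define e where "e k t = indicator {0<..} t * (exp (- (sqrt 2 * real (Suc k) * t)\<^sup>2) * t ^ m)" for k and t :: real
  define s where "s n t = (\<Sum>k<n. 2 * ((-1) ^ k * e k t))" for n t
  have sm[measurable]: "s n \<in> borel_measurable borel" for n unfolding s_def e_def by measurable
  have [measurable]: "e k \<in> borel_measurable borel" for k unfolding e_def by measurable
  have e: "has_bochner_integral lborel (e k) (I k)" for k using I[of k] unfolding e_def .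
  have s: "has_bochner_integral lborel (s n) (\<Sum>k<n. 2 * ((-1) ^ k * I k))" for n
    unfolding s_def by (intro has_bochner_integral_sum has_bochner_integral_mult_right e)
  have dom: "norm (s n t) \<le> 2 * e 0 t" for n t
  proof -
    have "decseq (\<lambda>k. e k t)"
      unfolding decseq_def e_def
      by (auto intro!: mult_right_mono power_mono mult_left_mono split: split_indicator)
    hence "0 \<le> (\<Sum>k<n. (-1)^k * e k t) \<and> (\<Sum>k<n. (-1)^k * e k t) \<le> e 0 t"
      by (rule alternating_sum_bounds) (auto simp: e_def split: split_indicator)
    thus ?thesis by (simp add: s_def sum_distrib_left[symmetric])
  qed
  have lim: "(\<lambda>n. s n t) \<longlonglongrightarrow> indicator {0<..} t * (t ^ m * T t)" for t
  proof (cases "t > 0")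
    case True
    have "(\<lambda>n. t ^ m * (\<Sum>k<n. 2 * ((-1) ^ k * exp (- (sqrt 2 * real (Suc k) * t)\<^sup>2)))) \<longlonglongrightarrow> t ^ m * T t"
      using T[OF True] unfolding sums_def by (intro tendsto_intros)
    thus ?thesis using True by (simp add: s_def e_def sum_distrib_left mult_ac)
  qed (simp add: s_def e_def)
  have w: "integrable lborel (\<lambda>t. 2 * e 0 t)" using e[of 0] by (simp add: has_bochner_integral_iff)
  have int: "integrable lborel (\<lambda>t. indicator {0<..} t * (t ^ m * T t))"
    by (rule integrable_dominated_convergence[where s=s and w="\<lambda>t. 2 * e 0 t"])
      (use dom lim w in auto)
  have "(\<lambda>n. \<Sum>k<n. 2 * ((-1) ^ k * I k)) \<longlonglongrightarrow> (LINT t|lborel. indicator {0<..} t * (t ^ m * T t))"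
    using integral_dominated_convergence[where s=s and w="\<lambda>t. 2 * e 0 t" and M=lborel and f="\<lambda>t. indicator {0<..} t * (t ^ m * T t)"]
      dom lim w s by (simp add: has_bochner_integral_iff)
  with L have "(LINT t|lborel. indicator {0<..} t * (t ^ m * T t)) = L"
    unfolding sums_def using LIMSEQ_unique by blast
  with int show ?thesis by (simp add: has_bochner_integral_iff)
qed

text \<open>The full series sums to \<open>\<pi>\<^sup>2/6\<close>, and its even-numbered terms carry a quarter of that.\<close>

lemma alternating_inverse_squares_sums: "(\<lambda>k. (-1) ^ k / (real (Suc k))\<^sup>2) sums (pi\<^sup>2 / 12)"
proof -
  define a where "a k = 1 / (real (Suc k))\<^sup>2" for k
  have a: "a sums (pi\<^sup>2 / 6)" using inverse_squares_sums by (simp add: a_def[abs_def] add.commute)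
  have "(\<lambda>k. 1/4 * a k) sums (1/4 * (pi\<^sup>2 / 6))" by (intro sums_mult a)
  hence "(\<lambda>k. if even k then 0 else 1/4 * a ((k - 1) div 2)) sums (pi\<^sup>2 / 24)"
    using sums_if'[of "\<lambda>k. 1/4 * a k" "pi\<^sup>2 / 24"] by (simp cong: if_cong)
  hence "(\<lambda>k. a k - 2 * (if even k then 0 else 1/4 * a ((k - 1) div 2))) sums (pi\<^sup>2 / 6 - 2 * (pi\<^sup>2 / 24))"
    by (intro sums_diff sums_mult a)
  also have "(\<lambda>k. a k - 2 * (if even k then 0 else 1/4 * a ((k - 1) div 2))) = (\<lambda>k. (-1) ^ k / (real (Suc k))\<^sup>2)"
    by (auto simp: a_def fun_eq_iff elim!: oddE simp: power2_eq_square field_simps)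
  finally show ?thesis by simp
qed

text \<open>For \<open>t > 0\<close> the tail of \<open>X\<close> is \<open>2 \<Sum>\<^sub>k\<^sub>\<ge>\<^sub>1 (-1)\<^sup>k\<^sup>-\<^sup>1 exp (-2 k\<^sup>2 t\<^sup>2)\<close>; the moments are integrals of this series.\<close>

lemma kolmogorov_moments:
  fixes X :: "'a \<Rightarrow> real"
  assumes "prob_space M" and X[measurable]: "X \<in> borel_measurable M" and pos: "\<And>\<omega>. \<omega> \<in> space M \<Longrightarrow> 0 \<le> X \<omega>"
    and cdf: "\<And>x. x > 0 \<Longrightarrow> measure M {\<omega> \<in> space M. X \<omega> \<le> x} =
           1 + 2 * (\<Sum>k. (-1) ^ Suc k * exp (- 2 * (real (Suc k))\<^sup>2 * x\<^sup>2))"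
  shows "has_bochner_integral M X (sqrt (2 * pi) / 2 * ln 2)"
    and "has_bochner_integral M (\<lambda>\<omega>. (X \<omega>)\<^sup>2) (pi\<^sup>2 / 12)"
proof -
  interpret prob_space M by fact
  define T where "T t = measure M {\<omega> \<in> space M. t < X \<omega>}" for t
  have [measurable]: "T \<in> borel_measurable borel"
  proof (rule borel_measurable_mono[of "\<lambda>t. - T t", THEN borel_measurable_uminus, simplified])
    show "mono (\<lambda>t. - T t)" unfolding T_def by (intro monoI) (auto intro!: finite_measure_mono)
  qed
  have T: "(\<lambda>k. 2 * ((-1) ^ k * exp (- (sqrt 2 * real (Suc k) * t)\<^sup>2))) sums T t" if "t > 0" for t
  proof -
    have "T t = 1 - measure M {\<omega> \<in> space M. X \<omega> \<le> t}"
      unfolding T_def by (subst prob_compl[symmetric]) (auto intro!: arg_cong[where f="measure M"])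
    also have "\<dots> = - 2 * (\<Sum>k. (-1) ^ Suc k * exp (- 2 * (real (Suc k))\<^sup>2 * t\<^sup>2))" using cdf[OF that] by simp
    finally have "(\<lambda>k. - 2 * ((-1) ^ Suc k * exp (- 2 * (real (Suc k))\<^sup>2 * t\<^sup>2))) sums T t"
      using sums_mult[OF summable_sums[OF theta_summable[OF that]], of "-2"] by (simp del: power_Suc)
    thus ?thesis by (simp add: power_mult_distrib)
  qed
  have moment: "has_bochner_integral M (\<lambda>\<omega>. X \<omega> ^ Suc m) (real (Suc m) * L)"
    if *: "has_bochner_integral lborel (\<lambda>t. indicator {0<..} t * (t ^ m * T t)) L" for m L
  proof (rule has_bochner_integral_nn_integral)
    have L: "0 \<le> L"
      using * by (auto simp: has_bochner_integral_iff T_def split: split_indicator intro!: integral_nonneg)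
    thus "0 \<le> real (Suc m) * L" by simp
    have "(\<integral>\<^sup>+\<omega>. ennreal (X \<omega> ^ Suc m) \<partial>M) = 
      (\<integral>\<^sup>+t. ennreal (indicator {0<..} t * (real (Suc m) * t ^ m)) * emeasure M {\<omega> \<in> space M. t < X \<omega>} \<partial>lborel)"
      by (intro nn_integral_power_layer_cake X pos) unfold_locales
    also have "\<dots> = (\<integral>\<^sup>+t. ennreal (real (Suc m) * (indicator {0<..} t * (t ^ m * T t))) \<partial>lborel)"
      by (intro nn_integral_cong) (auto simp: emeasure_eq_measure T_def ennreal_mult'[symmetric] mult_ac split: split_indicator)
    also have "\<dots> = ennreal (real (Suc m) * L)"
      using has_bochner_integral_mult_right[OF *, of "real (Suc m)"]
      by (subst nn_integral_eq_integral) (auto simp: has_bochner_integral_iff T_def split: split_indicator)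
    finally show "(\<integral>\<^sup>+\<omega>. ennreal (X \<omega> ^ Suc m) \<partial>M) = ennreal (real (Suc m) * L)" .
  qed (use pos in auto)
  have c: "sqrt 2 * real (Suc k) > 0" for k by simp
  have "(\<lambda>k. sqrt pi / sqrt 2 * ((-1)^k / real (Suc k))) sums (sqrt pi / sqrt 2 * ln 2)"
    by (intro sums_mult alternating_harmonic_series_sums)
  hence s1: "(\<lambda>k. 2 * ((-1)^k * (sqrt pi / (2 * (sqrt 2 * real (Suc k)))))) sums (sqrt pi / sqrt 2 * ln 2)"
    by (simp add: mult_ac del: of_nat_Suc)
  have "has_bochner_integral M X (sqrt pi / sqrt 2 * ln 2)"
    using moment[OF theta_tail_moment[OF _ T _ s1, of 0]] gaussian_half_moments(1)[OF c] by simp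
  moreover have "sqrt pi / sqrt 2 = sqrt (2*pi) / 2"
    by (simp add: real_sqrt_mult field_simps)
  ultimately show "has_bochner_integral M X (sqrt (2 * pi) / 2 * ln 2)" by metis
  have "(\<lambda>k. 1 / 2 * ((-1)^k / (real (Suc k))\<^sup>2)) sums (1 / 2 * (pi\<^sup>2 / 12))"
    by (intro sums_mult alternating_inverse_squares_sums)
  hence s2: "(\<lambda>k. 2 * ((-1)^k * (1 / (2 * (sqrt 2 * real (Suc k))\<^sup>2)))) sums (1 / 2 * (pi\<^sup>2 / 12))"
    by (simp add: power_mult_distrib mult_ac del: of_nat_Suc)
  with moment[OF theta_tail_moment[OF _ T _ s2, of 1]] gaussian_half_moments(2)[OF c]
  show "has_bochner_integral M (\<lambda>\<omega>. (X \<omega>)\<^sup>2) (pi\<^sup>2 / 12)" by (simp add: numeral_2_eq_2)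
qed

section \<open>Exchanging the mean of a Gaussian vector\<close>

abbreviation std_normal :: "real measure" where
  "std_normal \<equiv> density lborel (\<lambda>x. ennreal (std_normal_density x))"

interpretation lborel_prod: product_sigma_finite "\<lambda>_. lborel :: real measure" ..

lemma prob_space_std_normal: "prob_space std_normal"
  by (rule prob_space_normal_density) simp

lemma PiM_lborel_translate:
  assumes I: "finite I"
  shows "distr (PiM I (\<lambda>_. lborel)) (PiM I (\<lambda>_. lborel)) (\<lambda>x. \<lambda>i\<in>I. x i + c) = PiM I (\<lambda>_. lborel :: real measure)"
    (is "distr ?P ?P ?f = ?P")
proof (rule lborel_prod.PiM_eqI[OF I])
  have [measurable]: "?f \<in> measurable ?P ?P" by measurable
  fix A :: "'a \<Rightarrow> real set" assume A: "\<And>i. i \<in> I \<Longrightarrow> A i \<in> sets lborel"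
  have "emeasure (distr ?P ?P ?f) (Pi\<^sub>E I A) = emeasure ?P (?f -` Pi\<^sub>E I A \<inter> space ?P)"
    using A I by (intro emeasure_distr sets_PiM_I_finite) auto
  also have "?f -` Pi\<^sub>E I A \<inter> space ?P = Pi\<^sub>E I (\<lambda>i. (\<lambda>y. c + y) -` A i)"
    by (auto simp: space_PiM PiE_iff add.commute)
  also have "emeasure ?P \<dots> = (\<Prod>i\<in>I. emeasure lborel ((\<lambda>y. c + y) -` A i))"
  proof (intro lborel_prod.emeasure_PiM I)
    fix i assume "i \<in> I"
    thus "(+) c -` A i \<in> sets lborel" using A measurable_sets[of "(+) c" borel borel "A i"] by simp
  qed
  also have "\<dots> = (\<Prod>i\<in>I. emeasure lborel (A i))"
  proof (rule prod.cong[OF refl])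
    fix i assume "i \<in> I"
    hence "emeasure (distr lborel borel ((+) c)) (A i) = emeasure lborel ((\<lambda>y. c + y) -` A i)"
      using A by (subst emeasure_distr) auto
    thus "emeasure lborel ((\<lambda>y. c + y) -` A i) = emeasure lborel (A i)"
      by (simp add: lborel_distr_plus)
  qed
  finally show "emeasure (distr ?P ?P ?f) (Pi\<^sub>E I A) = (\<Prod>i\<in>I. emeasure lborel (A i))" .
qed simp

lemma PiM_std_normal_density:
  assumes I: "finite I"
  shows "PiM I (\<lambda>_. std_normal) = density (PiM I (\<lambda>_. lborel)) (\<lambda>x. ennreal (\<Prod>i\<in>I. std_normal_density (x i)))"
    (is "_ = density ?P ?d")
proof -
  interpret N: product_sigma_finite "\<lambda>_. std_normal"
    using prob_space_std_normal by (simp add: product_sigma_finite_def prob_space_imp_sigma_finite)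
  show ?thesis
  proof (rule N.PiM_eqI[OF I, symmetric])
    show "sets (density ?P ?d) = sets (PiM I (\<lambda>_. std_normal))" by (simp cong: sets_PiM_cong)
    fix A :: "'a \<Rightarrow> real set" assume "\<And>i. i \<in> I \<Longrightarrow> A i \<in> sets std_normal"
    hence A: "\<And>i. i \<in> I \<Longrightarrow> A i \<in> sets borel" by simp
    hence [measurable]: "Pi\<^sub>E I A \<in> sets ?P" using I by (intro sets_PiM_I_finite) auto
    have "emeasure (density ?P ?d) (Pi\<^sub>E I A) = (\<integral>\<^sup>+x. ?d x * indicator (Pi\<^sub>E I A) x \<partial>?P)"
      by (subst emeasure_density) auto
    also have "\<dots> = (\<integral>\<^sup>+x. (\<Prod>i\<in>I. ennreal (std_normal_density (x i)) * indicator (A i) (x i)) \<partial>?P)"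
    proof (rule nn_integral_cong)
      fix x assume "x \<in> space ?P"
      hence "indicator (Pi\<^sub>E I A) x = (\<Prod>i\<in>I. indicator (A i) (x i) :: ennreal)"
        using I by (auto simp: space_PiM PiE_iff indicator_def prod.If_cases)
      thus "?d x * indicator (Pi\<^sub>E I A) x = (\<Prod>i\<in>I. ennreal (std_normal_density (x i)) * indicator (A i) (x i))"
        by (simp add: prod.distrib prod_ennreal)
    qed
    also have "\<dots> = (\<Prod>i\<in>I. \<integral>\<^sup>+x. ennreal (std_normal_density x) * indicator (A i) x \<partial>lborel)"
      using A I by (intro lborel_prod.product_nn_integral_prod) auto
    also have "\<dots> = (\<Prod>i\<in>I. emeasure std_normal (A i))"
      using A by (intro prod.cong refl) (subst emeasure_density; auto)
    finally show "emeasure (density ?P ?d) (Pi\<^sub>E I A) = (\<Prod>i\<in>I. emeasure std_normal (A i))" .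
  qed
qed

text \<open>With \<open>u = (1, \<dots>, 1) / sqrt n\<close>, the vector is \<open>x - (x \<bullet> u) u + z u\<close>: the component of \<open>x\<close> along \<open>u\<close> is
  exchanged for the independent \<open>z\<close>.  This is part of a reflection of the space of pairs \<open>(x, z)\<close>, under
  which the Gaussian measure is invariant.  The proof replaces the reflection by two translations of
  Lebesgue measure, \<open>z\<close> by \<open>x \<bullet> u\<close> and \<open>x\<close> along \<open>u\<close> by \<open>-z\<close>, together with
  \<open>\<bar>x - z u\<bar>\<^sup>2 + (x \<bullet> u)\<^sup>2 = \<bar>x\<bar>\<^sup>2 + (z - x \<bullet> u)\<^sup>2\<close>.\<close>

lemma std_normal_replace_mean:
  fixes I :: "'i set"
  assumes I: "finite I" "I \<noteq> {}"
  defines "n \<equiv> real (card I)"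
  shows "distr (PiM I (\<lambda>_. std_normal) \<Otimes>\<^sub>M std_normal) (PiM I (\<lambda>_. borel))
    (\<lambda>(x, z). \<lambda>i\<in>I. x i - (\<Sum>j\<in>I. x j) / n + z / sqrt n) = PiM I (\<lambda>_. std_normal)"
proof (rule measure_eqI)
  let ?G = "PiM I (\<lambda>_. std_normal)" and ?P = "PiM I (\<lambda>_. lborel :: real measure)"
  let ?f = "\<lambda>(x, z). \<lambda>i\<in>I. x i - (\<Sum>j\<in>I. x j) / n + z / sqrt n"
  let ?D = "distr (?G \<Otimes>\<^sub>M std_normal) (PiM I (\<lambda>_. borel)) ?f"
  have sP[measurable_cong]: "sets ?G = sets (PiM I (\<lambda>_. borel))" "sets ?P = sets (PiM I (\<lambda>_. borel))"
    by (auto intro!: sets_PiM_cong)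
  show "sets ?D = sets ?G" by (simp add: sP)
  define s where "s x = (\<Sum>j\<in>I. x j) / sqrt n" for x :: "'i \<Rightarrow> real"
  define sh where "sh x c = (\<lambda>i\<in>I. x i + c / sqrt n)" for x :: "'i \<Rightarrow> real" and c
  define p where "p x = (\<Prod>i\<in>I. std_normal_density (x i))" for x :: "'i \<Rightarrow> real"
  have n: "n > 0" using I by (simp add: n_def card_gt_0_iff)
  have [measurable]: "s \<in> borel_measurable (PiM I (\<lambda>_. borel))"
    "(\<lambda>(x, c). sh x c) \<in> measurable (PiM I (\<lambda>_. borel) \<Otimes>\<^sub>M borel) (PiM I (\<lambda>_. borel))"
    "p \<in> borel_measurable (PiM I (\<lambda>_. borel))"
    unfolding s_def sh_def p_def by measurable
  have [measurable]: "sh x \<in> measurable borel (PiM I (\<lambda>_. borel))" for x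
    unfolding sh_def by measurable
  have p0: "0 \<le> p x" for x unfolding p_def by (intro prod_nonneg) simp
  have ssh: "s (sh x c) = s x + c" for x c
    using n by (simp add: s_def sh_def sum.distrib add_divide_distrib n_def[symmetric])
  \<comment> \<open>the identity between squared norms, in terms of densities\<close>
  have key: "p (sh x (- z)) * std_normal_density (s x) = p x * std_normal_density (z - s x)" for x z
  proof -
    have p: "p y = (1 / sqrt (2*pi)) ^ card I * exp (- (\<Sum>i\<in>I. (y i)\<^sup>2) / 2)" for y
      using I by (simp add: p_def std_normal_density_def prod_dividef power_one_over sum_divide_distrib sum_negf[symmetric] exp_sum)
    have "(\<Sum>i\<in>I. (sh x (-z) i)\<^sup>2) = (\<Sum>i\<in>I. (x i)\<^sup>2 - 2 * (z / sqrt n) * x i + z\<^sup>2 / n)"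
      using n by (intro sum.cong refl) (simp add: sh_def power2_diff power_divide)
    also have "\<dots> = (\<Sum>i\<in>I. (x i)\<^sup>2) - 2 * z * s x + z\<^sup>2"
      using n by (simp add: sum.distrib sum_subtractf sum_distrib_left sum_divide_distrib s_def n_def[symmetric])
    finally have "(\<Sum>i\<in>I. (sh x (-z) i)\<^sup>2) + (s x)\<^sup>2 = (\<Sum>i\<in>I. (x i)\<^sup>2) + (z - s x)\<^sup>2"
      by (simp add: power2_eq_square algebra_simps)
    hence "exp (- (\<Sum>i\<in>I. (sh x (-z) i)\<^sup>2) / 2) * exp (- (s x)\<^sup>2 / 2) = exp (- (\<Sum>i\<in>I. (x i)\<^sup>2) / 2) * exp (- (z - s x)\<^sup>2 / 2)"
      by (simp add: mult_exp_exp add_divide_distrib[symmetric] algebra_simps)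
    thus ?thesis by (simp add: p std_normal_density_def)
  qed
  have f_sh: "?f = (\<lambda>w. sh (fst w) (snd w - s (fst w)))"
  proof -
    have "s x / sqrt n = (\<Sum>j\<in>I. x j) / n" for x using n by (simp add: s_def)
    thus ?thesis by (auto simp: sh_def fun_eq_iff diff_divide_distrib)
  qed
  have sh_inv: "sh (sh x z) (- z) = x" if "x \<in> space ?P" for x z
    using that by (auto simp: sh_def space_PiM PiE_iff fun_eq_iff extensional_def)
  have trans: "(\<integral>\<^sup>+x. h (sh x c) \<partial>?P) = (\<integral>\<^sup>+x. h x \<partial>?P)" if [measurable]: "h \<in> borel_measurable (PiM I (\<lambda>_. borel))" for h c
    using that by (subst (2) PiM_lborel_translate[OF I(1), of "c / sqrt n", symmetric]) 
      (subst nn_integral_distr; simp add: sh_def)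
  interpret P: sigma_finite_measure ?P by (intro lborel_prod.sigma_finite I)
  interpret Pl: pair_sigma_finite ?P lborel ..
  interpret G: prob_space std_normal by (rule prob_space_std_normal)
  fix A assume "A \<in> sets ?D"
  hence A[measurable]: "A \<in> sets (PiM I (\<lambda>_. borel))" by simp
  have "emeasure ?D A = (\<integral>\<^sup>+w. indicator A (sh (fst w) (snd w - s (fst w))) \<partial>(?G \<Otimes>\<^sub>M std_normal))"
    unfolding f_sh by (subst nn_integral_indicator[symmetric]) (simp, subst nn_integral_distr, auto)
  also have "\<dots> = (\<integral>\<^sup>+x. \<integral>\<^sup>+z. indicator A (sh x (z - s x)) \<partial>std_normal \<partial>?G)"
    by (subst G.nn_integral_fst[symmetric]) auto
  also have "\<dots> = (\<integral>\<^sup>+x. \<integral>\<^sup>+z. ennreal (p x * std_normal_density z) * indicator A (sh x (z - s x)) \<partial>lborel \<partial>?P)"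
    unfolding PiM_std_normal_density[OF I(1)] p_def[symmetric]
    by (simp add: nn_integral_density nn_integral_cmult[symmetric] ennreal_mult p0 mult.assoc)
  \<comment> \<open>translate \<open>z\<close> by \<open>s x\<close>\<close>
  also have "\<dots> = (\<integral>\<^sup>+x. \<integral>\<^sup>+z. ennreal (p x * std_normal_density (s x + z)) * indicator A (sh x z) \<partial>lborel \<partial>?P)"
  proof (rule nn_integral_cong)
    fix x
    show "(\<integral>\<^sup>+z. ennreal (p x * std_normal_density z) * indicator A (sh x (z - s x)) \<partial>lborel) =
      (\<integral>\<^sup>+z. ennreal (p x * std_normal_density (s x + z)) * indicator A (sh x z) \<partial>lborel)"
      by (subst nn_integral_real_affine[where c=1 and t="s x"]) auto
  qed
  also have "\<dots> = (\<integral>\<^sup>+z. \<integral>\<^sup>+x. ennreal (p x * std_normal_density (s x + z)) * indicator A (sh x z) \<partial>?P \<partial>lborel)"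
    by (rule Pl.Fubini'[symmetric]) measurable
  \<comment> \<open>translate \<open>x\<close> along the diagonal by \<open>- z\<close>\<close>
  also have "\<dots> = (\<integral>\<^sup>+z. \<integral>\<^sup>+x. ennreal (p (sh x (- z)) * std_normal_density (s x)) * indicator A x \<partial>?P \<partial>lborel)"
  proof (rule nn_integral_cong)
    fix z :: real
    show "(\<integral>\<^sup>+x. ennreal (p x * std_normal_density (s x + z)) * indicator A (sh x z) \<partial>?P) =
      (\<integral>\<^sup>+x. ennreal (p (sh x (- z)) * std_normal_density (s x)) * indicator A x \<partial>?P)"
      by (subst trans[symmetric, of _ z]) (auto intro!: nn_integral_cong simp: sh_inv ssh)
  qed
  also have "\<dots> = (\<integral>\<^sup>+x. \<integral>\<^sup>+z. ennreal (p x * std_normal_density (z - s x)) * indicator A x \<partial>lborel \<partial>?P)"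
    unfolding key by (rule Pl.Fubini') measurable
  also have "\<dots> = (\<integral>\<^sup>+x. ennreal (p x) * indicator A x * (\<integral>\<^sup>+z. ennreal (std_normal_density (z - s x)) \<partial>lborel) \<partial>?P)"
    by (intro nn_integral_cong) (simp add: nn_integral_cmult[symmetric] ennreal_mult p0 mult_ac)
  also have "\<dots> = (\<integral>\<^sup>+x. ennreal (p x) * indicator A x \<partial>?P)"
  proof -
    have "(\<integral>\<^sup>+z. ennreal (std_normal_density (z - c)) \<partial>lborel) = 1" for c
      by (subst nn_integral_real_affine[where c=1 and t=c])
        (auto simp: nn_integral_eq_integral)
    thus ?thesis by simp
  qed
  also have "\<dots> = emeasure ?G A"
    unfolding PiM_std_normal_density[OF I(1)] p_def[symmetric] by (simp add: emeasure_density)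
  finally show "emeasure ?D A = emeasure ?G A" .
qed

section \<open>Random walks between two barriers\<close>

text \<open>Optional stopping with an error term.  The hypothesis \<open>mart\<close> makes \<open>v k (S k)\<close> a martingale.  Stop it at
  the first \<open>k\<close> with \<open>\<bar>S k\<bar> > x\<close>.  The walk overshoots \<open>x\<close> by at most one step, so there the hypothesis
  \<open>barrier\<close> makes the stopped value small; if the walk never leaves \<open>[-x, x]\<close>, the stopped value is
  \<open>v n (S n)\<close>.  In the application \<open>r\<close> and the largest step \<open>m\<close> become negligible.\<close>

lemma (in prob_space) random_walk_barrier:
  fixes \<xi> :: "nat \<Rightarrow> 'a \<Rightarrow> real" and v :: "nat \<Rightarrow> real \<Rightarrow> real" and m :: "'a \<Rightarrow> real"
  defines "S \<equiv> \<lambda>k \<omega>. \<Sum>j<k. \<xi> j \<omega>"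
  assumes ind: "indep_vars (\<lambda>_. borel) \<xi> {..<n}"
    and v: "\<And>k. v k \<in> borel_measurable borel" and C: "\<And>k y. \<bar>v k y\<bar> \<le> C"
    and mart: "\<And>k y. k < n \<Longrightarrow> (\<integral>\<omega>. v (Suc k) (y + \<xi> k \<omega>) \<partial>M) = v k y"
    and barrier: "\<And>k y. k \<le> n \<Longrightarrow> x < \<bar>y\<bar> \<Longrightarrow> \<bar>v k y\<bar> \<le> r + L * (\<bar>y\<bar> - x)"
    and x: "0 \<le> x" and L: "0 \<le> L" and r: "0 \<le> r"
    and m[measurable]: "m \<in> borel_measurable M" and step: "\<And>j \<omega>. j < n \<Longrightarrow> \<omega> \<in> space M \<Longrightarrow> \<bar>\<xi> j \<omega>\<bar> \<le> m \<omega>"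
    and m0: "\<And>\<omega>. 0 \<le> m \<omega>"
  shows "\<bar>(\<integral>\<omega>. (if \<forall>k\<in>{..n}. \<bar>S k \<omega>\<bar> \<le> x then v n (S n \<omega>) else 0) \<partial>M) - v 0 0\<bar> \<le> (\<integral>\<omega>. min C (r + L * m \<omega>) \<partial>M)"
proof -
  have \<xi>: "\<xi> j \<in> borel_measurable M" if "j < n" for j
    using ind that by (auto simp: indep_vars_def)
  have S: "S k \<in> borel_measurable M" if "k \<le> n" for k
    unfolding S_def using that by (intro borel_measurable_sum \<xi>) auto
  have C0: "0 \<le> C" using C[of 0 0] by simp
  define A where "A k \<omega> \<longleftrightarrow> (\<forall>j\<in>{..k}. \<bar>S j \<omega>\<bar> \<le> x)" for k \<omega>
  have A: "Measurable.pred M (A k)" if "k \<le> n" for k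
  proof -
    have "Measurable.pred M (\<lambda>\<omega>. \<forall>j\<in>{..k}. \<bar>S j \<omega>\<bar> \<le> x)"
    proof (intro pred_intros_finite)
      fix j assume "j \<in> {..k}"
      with that have [measurable]: "S j \<in> borel_measurable M" by (intro S) auto
      show "Measurable.pred M (\<lambda>\<omega>. \<bar>S j \<omega>\<bar> \<le> x)" by measurable
    qed simp
    thus ?thesis unfolding A_def .
  qed
  \<comment> \<open>\<open>D k\<close> is the increment of the stopped martingale, which moves only while the walk has not left \<open>[-x, x]\<close>.\<close>
  define D where "D k \<omega> = (if A k \<omega> then v (Suc k) (S (Suc k) \<omega>) - v k (S k \<omega>) else 0)" for k \<omega>
  have D: "D k \<in> borel_measurable M" if "k < n" for k
  proof -
    have [measurable]: "v k \<in> borel_measurable borel" "v (Suc k) \<in> borel_measurable borel" by (rule v)+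
    have [measurable]: "S k \<in> borel_measurable M" "S (Suc k) \<in> borel_measurable M" "Measurable.pred M (A k)"
      using that by (auto intro!: S A simp del: lessThan_Suc)
    show ?thesis unfolding D_def by measurable
  qed
  have D_bound: "\<bar>D k \<omega>\<bar> \<le> 2 * C" for k \<omega>
    using C[of "Suc k" "S (Suc k) \<omega>"] C[of k "S k \<omega>"] by (auto simp: D_def)
  have D_int: "integrable M (D k)" if "k < n" for k
    by (rule integrable_const_bound[where B="2*C", OF _ D[OF that]]) (simp add: D_bound)
  have D_zero: "(\<integral>\<omega>. D k \<omega> \<partial>M) = 0" if k: "k < n" for k
  proof -
    have [measurable]: "v k \<in> borel_measurable borel" "v (Suc k) \<in> borel_measurable borel" by (rule v)+
    have [measurable]: "\<xi> k \<in> borel_measurable M" by (rule \<xi>[OF k])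
    define R where "R \<omega> = (\<lambda>i\<in>{..<k}. \<xi> i \<omega>)" for \<omega>
    define P where "P = PiM {..<k} (\<lambda>_. borel :: real measure)"
    have [measurable]: "R \<in> measurable M P"
      unfolding R_def P_def using k by (intro measurable_restrict \<xi>) auto
    define Q where "Q = PiM {k} (\<lambda>_. borel :: real measure)"
    define R' where "R' \<omega> = (\<lambda>i\<in>{k}. \<xi> i \<omega>)" for \<omega>
    have R'k: "R' \<omega> k = \<xi> k \<omega>" for \<omega> by (simp add: R'_def)
    have [measurable]: "R' \<in> measurable M Q"
      unfolding R'_def Q_def using k by (intro measurable_restrict \<xi>) auto
    have [measurable]: "(\<lambda>z. z k) \<in> borel_measurable Q"
      unfolding Q_def by (intro measurable_component_singleton) simp
    have "indep_var P R Q R'"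
      unfolding R_def P_def R'_def Q_def using k by (intro indep_var_restrict[OF ind]) auto
    hence law: "distr M P R \<Otimes>\<^sub>M distr M Q R' = distr M (P \<Otimes>\<^sub>M Q) (\<lambda>\<omega>. (R \<omega>, R' \<omega>))"
      unfolding indep_var_distribution_eq by simp
    define s where "s j w = (\<Sum>i<j. w i)" for j and w :: "nat \<Rightarrow> real"
    have sR: "s j (R \<omega>) = S j \<omega>" if "j \<le> k" for j \<omega>
      using that by (auto simp: s_def S_def R_def intro!: sum.cong)
    have [measurable]: "s j \<in> borel_measurable P" if "j \<le> k" for j
      unfolding s_def P_def using that by (intro borel_measurable_sum measurable_component_singleton) auto
    \<comment> \<open>\<open>D k\<close> is a function of the past \<open>R\<close> and the next step \<open>R'\<close>, so Fubini reduces its mean to the martingale property.\<close>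
    define g where "g = (\<lambda>(w, z). if \<forall>j\<in>{..k}. \<bar>s j w\<bar> \<le> x then v (Suc k) (s k w + z k) - v k (s k w) else 0)"
    have [measurable]: "Measurable.pred P (\<lambda>w. \<forall>j\<in>{..k}. \<bar>s j w\<bar> \<le> x)"
      by (intro pred_intros_finite) auto
    have g[measurable]: "g \<in> borel_measurable (P \<Otimes>\<^sub>M Q)"
      unfolding g_def by measurable
    have Dg: "D k \<omega> = g (R \<omega>, R' \<omega>)" for \<omega>
    proof -
      have "S (Suc k) \<omega> = S k \<omega> + \<xi> k \<omega>" by (simp add: S_def)
      moreover have "(\<forall>j\<in>{..k}. \<bar>s j (R \<omega>)\<bar> \<le> x) \<longleftrightarrow> A k \<omega>" by (simp add: A_def sR)
      ultimately show ?thesis by (simp add: D_def g_def sR R'k)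
    qed
    interpret X: prob_space "distr M Q R'" using k by (intro prob_space_distr) auto
    interpret Y: prob_space "distr M P R" by (intro prob_space_distr) auto
    interpret XY: pair_prob_space "distr M P R" "distr M Q R'" ..
    have "(\<integral>\<omega>. D k \<omega> \<partial>M) = (\<integral>p. g p \<partial>(distr M P R \<Otimes>\<^sub>M distr M Q R'))"
      unfolding law Dg using k by (subst integral_distr) auto
    also have "\<dots> = (\<integral>w. \<integral>z. g (w, z) \<partial>distr M Q R' \<partial>distr M P R)"
    proof (rule XY.integral_fst'[symmetric])
      have "\<bar>v (Suc k) a - v k b\<bar> \<le> 2 * C" for a b
        using C[of "Suc k" a] C[of k b] by linarith
      hence "\<bar>g p\<bar> \<le> 2 * C" for p
        using C0 by (cases p) (simp add: g_def)
      thus "integrable (distr M P R \<Otimes>\<^sub>M distr M Q R') g"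
        by (intro XY.P.integrable_const_bound[where B="2*C"]) auto
    qed
    also have "\<dots> = (\<integral>w. 0 \<partial>distr M P R)"
    proof (rule Bochner_Integration.integral_cong[OF refl])
      fix w
      have vi: "integrable M (\<lambda>\<omega>. v (Suc k) (s k w + \<xi> k \<omega>))"
        using C k by (intro integrable_const_bound[where B=C]) auto
      have "(\<integral>z. g (w, z) \<partial>distr M Q R') = (\<integral>\<omega>. g (w, R' \<omega>) \<partial>M)"
        using k by (intro integral_distr) (auto simp: g_def)
      also have "\<dots> = 0"
      proof -
        obtain b where b: "(\<forall>j\<in>{..k}. \<bar>s j w\<bar> \<le> x) = b" by blast
        show ?thesis
          using vi mart[OF k, of "s k w"] unfolding g_def prod.case b by (cases b) (simp_all add: prob_space R'k)
      qed
      finally show "(\<integral>z. g (w, z) \<partial>distr M Q R') = 0" .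
    qed
    finally show ?thesis by simp
  qed
  \<comment> \<open>the stopped martingale\<close>
  define V where "V k \<omega> = v 0 0 + (\<Sum>j<k. D j \<omega>)" for k \<omega>
  have V_int: "integrable M (V n)" 
    unfolding V_def by (intro Bochner_Integration.integrable_add Bochner_Integration.integrable_sum D_int) auto
  have V_mean: "(\<integral>\<omega>. V n \<omega> \<partial>M) = v 0 0"
    unfolding V_def by (subst Bochner_Integration.integral_add) 
      (auto simp: D_int D_zero prob_space Bochner_Integration.integral_sum intro!: Bochner_Integration.integrable_sum)
  have V: "(A k \<omega> \<longrightarrow> V k \<omega> = v k (S k \<omega>)) \<and> (\<not> A k \<omega> \<longrightarrow> \<bar>V k \<omega>\<bar> \<le> min C (r + L * m \<omega>))"
    if "\<omega> \<in> space M" "k \<le> n" for k \<omega>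
    using that(2)
  proof (induction k)
    case 0
    thus ?case using x by (simp add: A_def V_def S_def)
  next
    case (Suc k)
    show ?case
    proof (cases "A k \<omega>")
      case True
      hence eq: "V (Suc k) \<omega> = v (Suc k) (S (Suc k) \<omega>)" using Suc by (simp add: V_def D_def)
      have "\<bar>V (Suc k) \<omega>\<bar> \<le> min C (r + L * m \<omega>)" if "\<not> A (Suc k) \<omega>"
      proof -
        have gt: "x < \<bar>S (Suc k) \<omega>\<bar>" using that True by (auto simp: A_def le_Suc_eq)
        have "\<bar>S k \<omega>\<bar> \<le> x" using True by (auto simp: A_def)
        moreover have "\<bar>\<xi> k \<omega>\<bar> \<le> m \<omega>" using step Suc.prems \<open>\<omega> \<in> space M\<close> by auto
        ultimately have "\<bar>S (Suc k) \<omega>\<bar> - x \<le> m \<omega>" by (simp add: S_def)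
        with barrier[OF Suc.prems gt] L have "\<bar>v (Suc k) (S (Suc k) \<omega>)\<bar> \<le> r + L * m \<omega>"
          by (meson add_left_mono mult_left_mono order_trans)
        with C show ?thesis by (simp add: eq)
      qed
      with eq show ?thesis by simp
    next
      case False
      hence "\<not> A (Suc k) \<omega>" by (auto simp: A_def)
      with False Suc show ?thesis by (simp add: V_def D_def)
    qed
  qed
  define U where "U \<omega> = (if A n \<omega> then v n (S n \<omega>) else 0)" for \<omega>
  have U_int: "integrable M U"
  proof (rule integrable_const_bound[where B=C])
    have [measurable]: "v n \<in> borel_measurable borel" "S n \<in> borel_measurable M" "Measurable.pred M (A n)"
      by (simp_all add: S A v)
    show "U \<in> borel_measurable M" unfolding U_def by measurable
  qed (use C C0 in \<open>auto simp: U_def\<close>)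
  have b0: "0 \<le> min C (r + L * m \<omega>)" for \<omega> using C0 r L m0 by auto
  have bi: "integrable M (\<lambda>\<omega>. min C (r + L * m \<omega>))"
    by (rule integrable_const_bound[where B=C]) (use b0 C0 in auto)
  have "(\<integral>\<omega>. U \<omega> \<partial>M) - v 0 0 = (\<integral>\<omega>. U \<omega> - V n \<omega> \<partial>M)"
    using U_int V_int by (simp add: V_mean)
  also have "\<bar>\<dots>\<bar> \<le> (\<integral>\<omega>. \<bar>U \<omega> - V n \<omega>\<bar> \<partial>M)" by (rule integral_abs_bound)
  also have "\<dots> \<le> (\<integral>\<omega>. min C (r + L * m \<omega>) \<partial>M)"
  proof (rule integral_mono)
    show "\<bar>U \<omega> - V n \<omega>\<bar> \<le> min C (r + L * m \<omega>)" if "\<omega> \<in> space M" for \<omega>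
      using V[OF that, of n] b0[of \<omega>] by (auto simp: U_def)
  qed (use U_int V_int bi in auto)
  finally show ?thesis unfolding U_def A_def .
qed

section \<open>Heat kernels and the method of images\<close>

text \<open>Parametrised by the variance, which plays the role of time; \<open>normal_density\<close> takes the standard deviation.\<close>

definition heat_kernel :: "real \<Rightarrow> real \<Rightarrow> real" where
  "heat_kernel s = normal_density 0 (sqrt s)"

text \<open>The method of images for the heat equation on \<open>[-x, x]\<close> with zero boundary values: the solution that starts at the
  origin, reflected with alternating signs into the multiples of \<open>2x\<close>, and truncated after \<open>K\<close> reflections on either side.\<close>

definition images :: "nat \<Rightarrow> real \<Rightarrow> real \<Rightarrow> real \<Rightarrow> real" where
  "images K x s y = heat_kernel s y + (\<Sum>k<K. (-1) ^ Suc k *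
     (heat_kernel s (y - 2 * real (Suc k) * x) + heat_kernel s (y + 2 * real (Suc k) * x)))"

lemma heat_kernel_altdef: "s > 0 \<Longrightarrow> heat_kernel s y = exp (- y\<^sup>2 / (2 * s)) / sqrt (2 * pi * s)"
  by (simp add: heat_kernel_def normal_density_def)

lemma heat_kernel_nonneg [simp]: "0 \<le> heat_kernel s y"
  by (simp add: heat_kernel_def)

lemma heat_kernel_minus: "s > 0 \<Longrightarrow> heat_kernel s (- y) = heat_kernel s y"
  by (simp add: heat_kernel_altdef)

lemma heat_kernel_abs_mono: "s > 0 \<Longrightarrow> \<bar>y\<bar> \<le> \<bar>z\<bar> \<Longrightarrow> heat_kernel s z \<le> heat_kernel s y"
  by (auto simp: heat_kernel_altdef abs_le_square_iff intro!: divide_right_mono)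

lemma borel_measurable_heat_kernel [measurable]: "heat_kernel s \<in> borel_measurable borel"
  by (simp add: heat_kernel_def)

lemma borel_measurable_images [measurable]: "images K x s \<in> borel_measurable borel"
  unfolding images_def by measurable

text \<open>In units of the standard deviation this is \<open>r exp (- r\<^sup>2/2) \<le> sqrt (2 \<pi>)\<close>.  The bound does not depend on
  the time \<open>s\<close>; it controls both the slope of the kernel and the remote images.\<close>

lemma heat_kernel_times_abs_le:
  assumes "s > 0"
  shows "\<bar>y\<bar> * heat_kernel s y \<le> 1"
proof -
  define r where "r = \<bar>y\<bar> / sqrt s"
  have r2: "r\<^sup>2 = y\<^sup>2 / s" using assms by (simp add: r_def power_divide)
  have "0 \<le> (r - 1)\<^sup>2" by simp
  hence "r \<le> 1 + r\<^sup>2 / 2" by (simp add: power2_eq_square algebra_simps)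
  also have "\<dots> \<le> exp (r\<^sup>2 / 2)" by (rule exp_ge_add_one_self)
  finally have "r * exp (- (r\<^sup>2 / 2)) \<le> 1" by (simp add: exp_minus field_simps)
  moreover have "1 \<le> sqrt (2 * pi)" using pi_gt3 by simp
  ultimately have "r * exp (- (r\<^sup>2 / 2)) \<le> sqrt (2 * pi)" by linarith
  hence "r * exp (- (r\<^sup>2 / 2)) / sqrt (2 * pi) \<le> 1" by (simp add: divide_le_eq)
  also have "r * exp (- (r\<^sup>2 / 2)) / sqrt (2 * pi) = \<bar>y\<bar> * heat_kernel s y"
    using assms by (simp add: r2 heat_kernel_altdef r_def real_sqrt_mult field_simps)
  finally show ?thesis .
qed

lemma heat_kernel_le:
  assumes "\<eta> > 0" "\<eta> \<le> s"
  shows "heat_kernel s y \<le> 1 / sqrt \<eta>"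
proof -
  have "heat_kernel s y \<le> heat_kernel s 0" using assms by (intro heat_kernel_abs_mono) auto
  also have "\<dots> = 1 / sqrt (2 * pi * s)" using assms by (simp add: heat_kernel_altdef)
  also have "\<dots> \<le> 1 / sqrt \<eta>"
  proof -
    have "1 * \<eta> \<le> (2 * pi) * s" using assms pi_gt3 by (intro mult_mono) auto
    thus ?thesis using assms by (intro divide_left_mono) auto
  qed
  finally show ?thesis .
qed

lemma heat_kernel_lipschitz:
  assumes "\<eta> > 0" "\<eta> \<le> s"
  shows "\<bar>heat_kernel s y - heat_kernel s z\<bar> \<le> 1 / \<eta> * \<bar>y - z\<bar>"
proof -
  have "norm (heat_kernel s y - heat_kernel s z) \<le> 1 / \<eta> * norm (y - z)"
  proof (rule field_differentiable_bound[OF convex_UNIV])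
    fix u :: real
    have "((\<lambda>u. exp (- u\<^sup>2 / (2 * s)) / sqrt (2 * pi * s)) has_real_derivative
       - (u / s) * (exp (- u\<^sup>2 / (2 * s)) / sqrt (2 * pi * s))) (at u)"
      using assms by (auto intro!: derivative_eq_intros simp: field_simps)
    moreover have "heat_kernel s = (\<lambda>u. exp (- u\<^sup>2 / (2 * s)) / sqrt (2 * pi * s))"
      using assms by (intro ext heat_kernel_altdef) simp
    ultimately show "(heat_kernel s has_field_derivative - (u / s) * heat_kernel s u) (at u within UNIV)"
      by simp
    have "norm (- (u / s) * heat_kernel s u) = 1 / s * (\<bar>u\<bar> * heat_kernel s u)"
      using assms by (simp add: abs_mult)
    also have "\<dots> \<le> 1 / s * 1" using assms by (intro mult_left_mono heat_kernel_times_abs_le) auto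
    also have "\<dots> \<le> 1 / \<eta>" using assms by (simp add: frac_le)
    finally show "norm (- (u / s) * heat_kernel s u) \<le> 1 / \<eta>" .
  qed auto
  thus ?thesis by simp
qed

lemma images_bound:
  assumes "\<eta> > 0" "\<eta> \<le> s"
  shows "\<bar>images K x s y\<bar> \<le> (2 * real K + 1) / sqrt \<eta>"
proof -
  have "\<bar>images K x s y\<bar> \<le> \<bar>heat_kernel s y\<bar> + \<bar>\<Sum>k<K. (-1) ^ Suc k *
     (heat_kernel s (y - 2 * real (Suc k) * x) + heat_kernel s (y + 2 * real (Suc k) * x))\<bar>"
    unfolding images_def by (rule abs_triangle_ineq)
  also have "\<dots> \<le> 1 / sqrt \<eta> + (\<Sum>k<K. 2 / sqrt \<eta>)"
  proof (intro add_mono order_trans[OF sum_abs] sum_mono)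
    show "\<bar>heat_kernel s y\<bar> \<le> 1 / sqrt \<eta>" using heat_kernel_le[OF assms] by simp
    show "\<bar>(-1) ^ Suc k * (heat_kernel s (y - 2 * real (Suc k) * x) + heat_kernel s (y + 2 * real (Suc k) * x))\<bar> \<le> 2 / sqrt \<eta>" for k
      using heat_kernel_le[OF assms, of "y - 2 * real (Suc k) * x"] heat_kernel_le[OF assms, of "y + 2 * real (Suc k) * x"]
      by (simp add: abs_mult)
  qed
  also have "\<dots> = (2 * real K + 1) / sqrt \<eta>" by (simp add: add_divide_distrib)
  finally show ?thesis .
qed

text \<open>The number of images enters the constant, but the time \<open>s\<close> does not, as long as it is at least \<open>\<eta>\<close>.\<close>

lemma images_lipschitz:
  assumes "\<eta> > 0" "\<eta> \<le> s"
  shows "\<bar>images K x s y - images K x s z\<bar> \<le> (2 * real K + 1) / \<eta> * \<bar>y - z\<bar>"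
proof -
  define d where "d = 1 / \<eta> * \<bar>y - z\<bar>"
  have h: "\<bar>heat_kernel s (y + c) - heat_kernel s (z + c)\<bar> \<le> d" for c
    using heat_kernel_lipschitz[OF assms, of "y + c" "z + c"] by (simp add: d_def)
  have "\<bar>images K x s y - images K x s z\<bar> \<le> (2 * real K + 1) * d"
  proof (induction K)
    case 0
    show ?case using h[of 0] by (simp add: images_def)
  next
    case (Suc K)
    define c where "c = 2 * real (Suc K) * x"
    define p where "p u = heat_kernel s (u - c) + heat_kernel s (u + c)" for u
    have step: "images (Suc K) x s u = images K x s u + (-1) ^ Suc K * p u" for u
      by (simp add: images_def p_def c_def)
    have "\<bar>(-1) ^ Suc K * p y - (-1) ^ Suc K * p z\<bar> = \<bar>p y - p z\<bar>"
      by (cases "even K") auto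
    also have "\<dots> \<le> 2 * d" using h[of "- c"] h[of c] by (simp add: p_def)
    finally have "\<bar>images (Suc K) x s y - images (Suc K) x s z\<bar> \<le> (2 * real K + 1) * d + 2 * d"
      using Suc unfolding step by linarith
    thus ?case by (simp add: algebra_simps)
  qed
  thus ?thesis by (simp add: d_def)
qed

text \<open>At the barrier the right image number \<open>k\<close> and the left image number \<open>k - 1\<close> are equally far away and have
  opposite signs; only the last left image stays unpaired.\<close>

lemma images_at_barrier:
  assumes "s > 0"
  shows "images K x s x = (-1) ^ K * heat_kernel s ((2 * real K + 1) * x)"
proof (induction K)
  case (Suc K)
  have "images (Suc K) x s x = images K x s x + (-1) ^ Suc K *
     (heat_kernel s (x - 2 * real (Suc K) * x) + heat_kernel s (x + 2 * real (Suc K) * x))"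
    by (simp add: images_def)
  also have "heat_kernel s (x - 2 * real (Suc K) * x) = heat_kernel s ((2 * real K + 1) * x)"
    using heat_kernel_minus[OF assms, of "(2 * real K + 1) * x"] by (simp add: algebra_simps)
  finally show ?case using Suc by (simp add: algebra_simps)
qed (simp add: images_def)

lemma images_minus:
  assumes "s > 0"
  shows "images K x s (- y) = images K x s y"
proof -
  have "heat_kernel s (- y - c) = heat_kernel s (y + c)" "heat_kernel s (- y + c) = heat_kernel s (y - c)" for c
    using heat_kernel_minus[OF assms, of "y + c"] heat_kernel_minus[OF assms, of "y - c"] by simp_all
  thus ?thesis using heat_kernel_minus[OF assms] by (simp add: images_def add.commute)
qed

text \<open>This is the form in which the vanishing of the infinite sum of images at \<open>\<plusminus>x\<close> is used: for finitely many
  images there is an error, which tends to \<open>0\<close> with \<open>K \<rightarrow> \<infinity>\<close> uniformly in \<open>s\<close>.\<close>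

lemma images_beyond_barrier:
  assumes \<eta>: "\<eta> > 0" "\<eta> \<le> s" and x: "0 < x" "x < \<bar>y\<bar>"
  shows "\<bar>images K x s y\<bar> \<le> 1 / ((2 * real K + 1) * x) + (2 * real K + 1) / \<eta> * (\<bar>y\<bar> - x)"
proof -
  have s: "s > 0" using \<eta> by simp
  have K: "0 < (2 * real K + 1) * x" using x by (intro mult_pos_pos) auto
  have "images K x s y = images K x s \<bar>y\<bar>" using images_minus[OF s, of K x y] by (cases "y \<ge> 0") auto
  moreover have "\<bar>images K x s x\<bar> = heat_kernel s ((2 * real K + 1) * x)"
    by (simp add: images_at_barrier[OF s] abs_mult)
  moreover have "heat_kernel s ((2 * real K + 1) * x) \<le> 1 / ((2 * real K + 1) * x)"
    using heat_kernel_times_abs_le[OF s, of "(2 * real K + 1) * x"] K by (simp add: field_simps)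
  moreover have "\<bar>images K x s \<bar>y\<bar> - images K x s x\<bar> \<le> (2 * real K + 1) / \<eta> * (\<bar>y\<bar> - x)"
    using images_lipschitz[OF \<eta>, of K x "\<bar>y\<bar>" x] x by simp
  ultimately show ?thesis by linarith
qed

lemma images_origin:
  assumes "s > 0"
  shows "images K x s 0 = heat_kernel s 0 + 2 * (\<Sum>k<K. (-1) ^ Suc k * heat_kernel s (2 * real (Suc k) * x))"
  using heat_kernel_minus[OF assms] by (simp add: images_def sum_distrib_left mult_ac)

text \<open>Convolving normal densities adds variances: averaging over a normal step advances the heat flow.\<close>

lemma (in prob_space) heat_kernel_expectation:
  assumes \<xi>: "distributed M lborel \<xi> (normal_density 0 \<tau>)" and \<tau>: "0 < \<tau>" and s: "0 < s"
  shows "(\<integral>\<omega>. heat_kernel s (y + \<xi> \<omega>) \<partial>M) = heat_kernel (s + \<tau>\<^sup>2) y"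
proof -
  have \<xi>': "distributed M lborel (\<lambda>\<omega>. 0 + (-1) * \<xi> \<omega>) (normal_density 0 \<tau>)"
    using normal_density_affine[OF \<xi> \<tau>, of "-1" 0] by simp
  have "(\<integral>\<omega>. heat_kernel s (y + \<xi> \<omega>) \<partial>M) = (\<integral>\<omega>. heat_kernel s (y - (0 + (-1) * \<xi> \<omega>)) \<partial>M)" by simp
  also have "\<dots> = (\<integral>z. normal_density 0 \<tau> z * heat_kernel s (y - z) \<partial>lborel)"
    by (rule distributed_integral[OF \<xi>', symmetric]) auto
  also have "\<dots> = enn2real (\<integral>\<^sup>+z. ennreal (normal_density 0 (sqrt s) (y - z) * normal_density 0 \<tau> z) \<partial>lborel)"
    by (subst integral_eq_nn_integral) (auto simp: heat_kernel_def mult.commute)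
  also have "\<dots> = heat_kernel (s + \<tau>\<^sup>2) y"
    using fun_cong[OF conv_normal_density_zero_mean[of "sqrt s" \<tau>], of y] s \<tau> by (simp add: heat_kernel_def)
  finally show ?thesis .
qed

lemma (in prob_space) images_expectation:
  assumes \<xi>: "distributed M lborel \<xi> (normal_density 0 \<tau>)" and \<tau>: "0 < \<tau>" and s: "0 < s"
  shows "(\<integral>\<omega>. images K x s (y + \<xi> \<omega>) \<partial>M) = images K x (s + \<tau>\<^sup>2) y"
proof -
  have [measurable]: "\<xi> \<in> borel_measurable M" using \<xi> by (auto simp: distributed_def)
  have shift: "(\<integral>\<omega>. heat_kernel s (y + \<xi> \<omega> - c) \<partial>M) = heat_kernel (s + \<tau>\<^sup>2) (y - c)"
    "(\<integral>\<omega>. heat_kernel s (y + \<xi> \<omega> + c) \<partial>M) = heat_kernel (s + \<tau>\<^sup>2) (y + c)" for c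
    using heat_kernel_expectation[OF assms, of "y - c"] heat_kernel_expectation[OF assms, of "y + c"]
    by (simp_all add: algebra_simps)
  have [simp]: "integrable M (\<lambda>\<omega>. heat_kernel s (f \<omega>))" if "f \<in> borel_measurable M" for f
    by (rule integrable_const_bound[where B="1 / sqrt s"]) (use heat_kernel_le[of s s] s that in auto)
  show ?thesis
    unfolding images_def by (simp add: shift heat_kernel_expectation[OF assms])
qed

text \<open>For \<open>\<bar>y\<bar> \<le> x\<close> all reflected centres have distance at least \<open>x\<close> from \<open>y\<close>.\<close>

lemma images_near_origin:
  assumes s: "s > 0" and y: "\<bar>y\<bar> \<le> x"
  shows "\<bar>images K x s y - heat_kernel s y\<bar> \<le> 2 * real K * heat_kernel s x"
proof -
  have "\<bar>images K x s y - heat_kernel s y\<bar> \<le> (\<Sum>k<K. 2 * heat_kernel s x)"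
    unfolding images_def add_diff_cancel_left'
  proof (intro order_trans[OF sum_abs] sum_mono)
    fix k
    define c where "c = 2 * real (Suc k) * x"
    have "2 * x \<le> c" unfolding c_def using y by (intro mult_right_mono) auto
    hence "heat_kernel s (y - c) \<le> heat_kernel s x" "heat_kernel s (y + c) \<le> heat_kernel s x"
      using y by (auto intro!: heat_kernel_abs_mono s)
    moreover have "\<bar>(-1) ^ Suc k * (heat_kernel s (y - c) + heat_kernel s (y + c))\<bar> = heat_kernel s (y - c) + heat_kernel s (y + c)"
      by (simp add: abs_mult)
    ultimately show "\<bar>(-1) ^ Suc k * (heat_kernel s (y - 2 * real (Suc k) * x) + heat_kernel s (y + 2 * real (Suc k) * x))\<bar> \<le> 2 * heat_kernel s x"
      unfolding c_def[symmetric] by linarith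
  qed
  thus ?thesis by simp
qed

text \<open>Away from its centre the kernel vanishes as \<open>\<eta> \<rightarrow> 0\<close>; the crude estimate \<open>exp (- u) \<le> 1/u\<close> suffices.\<close>

lemma heat_kernel_small_time:
  assumes "\<delta> > 0" "\<eta> > 0"
  shows "heat_kernel \<eta> \<delta> \<le> 2 / \<delta>\<^sup>2 * sqrt \<eta>"
proof -
  define u where "u = \<delta>\<^sup>2 / (2 * \<eta>)"
  have u: "u > 0" using assms by (simp add: u_def)
  have "u \<le> exp u" using exp_ge_add_one_self[of u] by linarith
  hence "exp (- u) \<le> 1 / u" using u by (simp add: exp_minus field_simps)
  moreover have "heat_kernel \<eta> \<delta> = exp (- u) / sqrt (2 * pi * \<eta>)"
    using assms by (simp add: heat_kernel_altdef u_def)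
  ultimately have "heat_kernel \<eta> \<delta> \<le> 1 / u / sqrt (2 * pi * \<eta>)"
    using assms by (simp only: divide_right_mono real_sqrt_ge_zero mult_nonneg_nonneg pi_ge_zero less_imp_le zero_le_numeral)
  also have "\<dots> \<le> 1 / u / sqrt \<eta>"
  proof -
    have "1 * \<eta> \<le> (2 * pi) * \<eta>" using assms pi_gt3 by (intro mult_right_mono) auto
    thus ?thesis using assms u by (intro divide_left_mono) auto
  qed
  also have "1 / u / sqrt \<eta> = 2 / \<delta>\<^sup>2 * (\<eta> / sqrt \<eta>)" using assms by (simp add: u_def)
  also have "\<eta> / sqrt \<eta> = sqrt \<eta>" using assms by (simp add: real_div_sqrt)
  finally show ?thesis .
qed

section \<open>Independent normal families and their laws\<close>

lemma (in prob_space) iid_law: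
  assumes "indep_vars (\<lambda>_. borel) X I" "I \<noteq> {}"
    and d: "\<And>i. i \<in> I \<Longrightarrow> distributed M lborel (X i) f"
  shows "distr M (PiM I (\<lambda>_. borel)) (\<lambda>\<omega>. \<lambda>i\<in>I. X i \<omega>) = PiM I (\<lambda>_. density lborel f :: real measure)"
proof -
  have "random_variable borel (X i)" if "i \<in> I" for i using d[OF that] by (simp add: distributed_def)
  hence "distr M (PiM I (\<lambda>_. borel)) (\<lambda>\<omega>. \<lambda>i\<in>I. X i \<omega>) = PiM I (\<lambda>i. distr M borel (X i))"
    using assms(1,2) by (subst (asm) indep_vars_iff_distr_eq_PiM') auto
  also have "\<dots> = PiM I (\<lambda>_. density lborel f)"
  proof (rule PiM_cong[OF refl])
    fix i assume "i \<in> I"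
    have "distr M borel (X i) = distr M lborel (X i)" by (rule distr_cong) auto
    thus "distr M borel (X i) = density lborel f" using d[OF \<open>i \<in> I\<close>] by (simp add: distributed_def)
  qed
  finally show ?thesis .
qed

lemma (in prob_space) iid_of_law:
  fixes X :: "'i \<Rightarrow> 'a \<Rightarrow> real"
  assumes I: "I \<noteq> {}" and X: "\<And>i. i \<in> I \<Longrightarrow> X i \<in> borel_measurable M"
    and f: "prob_space (density lborel f)" "f \<in> borel_measurable lborel"
    and law: "distr M (PiM I (\<lambda>_. borel)) (\<lambda>\<omega>. \<lambda>i\<in>I. X i \<omega>) = PiM I (\<lambda>_. density lborel f)"
  shows "indep_vars (\<lambda>_. borel) X I" and "\<And>i. i \<in> I \<Longrightarrow> distributed M lborel (X i) f"
proof -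
  have R: "(\<lambda>\<omega>. \<lambda>i\<in>I. X i \<omega>) \<in> measurable M (PiM I (\<lambda>_. borel))" by (intro measurable_restrict X)
  have marginal: "distr M borel (X i) = density lborel f" if "i \<in> I" for i
  proof -
    have "density lborel f = distr (PiM I (\<lambda>_. density lborel f)) (density lborel f) (\<lambda>\<omega>. \<omega> i)"
      using f(1) that by (intro distr_PiM_component[symmetric])
    also have "\<dots> = distr (PiM I (\<lambda>_. density lborel f)) borel (\<lambda>\<omega>. \<omega> i)" by (rule distr_cong) auto
    also have "\<dots> = distr M borel (\<lambda>\<omega>. (\<lambda>i\<in>I. X i \<omega>) i)"
      unfolding law[symmetric] using that R by (subst distr_distr) (auto simp: o_def measurable_component_singleton)
    also have "\<dots> = distr M borel (X i)" using that by simp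
    finally show ?thesis ..
  qed
  show "indep_vars (\<lambda>_. borel) X I"
    using I X law by (subst indep_vars_iff_distr_eq_PiM') (auto simp: marginal cong: PiM_cong)
  fix i assume i: "i \<in> I"
  have "distr M lborel (X i) = distr M borel (X i)" by (rule distr_cong) auto
  thus "distributed M lborel (X i) f" using marginal[OF i] X[OF i] f(2) by (simp add: distributed_def)
qed

lemma (in prob_space) indep_vars_reindex:
  assumes ind: "indep_vars (\<lambda>_. N) X I" and f: "inj_on f J" "f ` J \<subseteq> I"
  shows "indep_vars (\<lambda>_. N) (\<lambda>j. X (f j)) J"
proof -
  \<comment> \<open>Reindexing is the grouping of the variables into the singletons \<open>{f j}\<close>.\<close>
  have "indep_vars (\<lambda>j. PiM {f j} (\<lambda>_. N)) (\<lambda>j \<omega>. \<lambda>i\<in>{f j}. X i \<omega>) J"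
    using f by (intro indep_vars_restrict[OF ind]) (auto simp: disjoint_family_on_def inj_on_def)
  from indep_vars_compose2[OF this, of "\<lambda>j w. w (f j)" "\<lambda>_. N"] show ?thesis
    by (simp add: measurable_component_singleton)
qed

section \<open>Increments of the Brownian bridge\<close>

lemma wiener_increments_law:
  assumes W: "wiener_process P W" and n: "n \<ge> 1"
  shows "distr P (PiM {..<n} (\<lambda>_. borel)) (\<lambda>\<omega>. \<lambda>j\<in>{..<n}. sqrt n * (W (real (Suc j) / n) \<omega> - W (real j / n) \<omega>)) =
    PiM {..<n} (\<lambda>_. std_normal)"
proof -
  interpret prob_space P using W by (simp add: wiener_process_def)
  define \<tau> where "\<tau> j = real j / real n" for j
  have \<tau>: "\<forall>i\<le>n. \<tau> i \<in> {0..1}" "\<forall>i<n. \<tau> i < \<tau> (Suc i)"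
    using n by (auto simp: \<tau>_def field_simps)
  have "indep_vars (\<lambda>_. borel) (\<lambda>i \<omega>. W (\<tau> (Suc i)) \<omega> - W (\<tau> i) \<omega>) {..<n}"
    using W \<tau> unfolding wiener_process_def by blast
  hence ind: "indep_vars (\<lambda>_. borel) (\<lambda>i \<omega>. sqrt n * (W (\<tau> (Suc i)) \<omega> - W (\<tau> i) \<omega>)) {..<n}"
    by (rule indep_vars_compose2) measurable
  have "distributed P lborel (\<lambda>\<omega>. sqrt n * (W (\<tau> (Suc j)) \<omega> - W (\<tau> j) \<omega>)) std_normal_density" if "j < n" for j
  proof -
    have "0 \<le> \<tau> j" "\<tau> j < \<tau> (Suc j)" "\<tau> (Suc j) \<le> 1" using \<tau> that by (auto simp: \<tau>_def)
    hence "distributed P lborel (\<lambda>\<omega>. W (\<tau> (Suc j)) \<omega> - W (\<tau> j) \<omega>) (normal_density 0 (sqrt (\<tau> (Suc j) - \<tau> j)))"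
      using W unfolding wiener_process_def by blast
    also have "\<tau> (Suc j) - \<tau> j = 1 / real n" by (simp add: \<tau>_def add_divide_distrib)
    finally have *: "distributed P lborel (\<lambda>\<omega>. W (\<tau> (Suc j)) \<omega> - W (\<tau> j) \<omega>) (normal_density 0 (sqrt (1 / real n)))" .
    have "sqrt n * sqrt (1 / real n) = 1" using n by (simp add: real_sqrt_divide)
    thus ?thesis using normal_density_affine[OF *, of "sqrt n" 0] n by simp
  qed
  from iid_law[OF ind _ this] show ?thesis using n by (auto simp: \<tau>_def lessThan_empty_iff)
qed

text \<open>The path law of \<open>B\<close> determines the joint law of its increments, so \<open>B\<close> may be replaced by \<open>W\<^sub>s - s W\<^sub>1\<close>.
  Its scaled increments are those of \<open>W\<close> minus \<open>W\<^sub>1 / sqrt n\<close>, and the latter is their mean.\<close>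

lemma bridge_increments_law:
  assumes B: "brownian_bridge N B" and n: "n \<ge> 1"
  shows "distr N (PiM {..<n} (\<lambda>_. borel)) (\<lambda>\<omega>. \<lambda>j\<in>{..<n}. sqrt n * (B (real (Suc j) / n) \<omega> - B (real j / n) \<omega>)) =
    distr (PiM {..<n} (\<lambda>_. std_normal)) (PiM {..<n} (\<lambda>_. borel)) (\<lambda>x. \<lambda>j\<in>{..<n}. x j - (\<Sum>i\<in>{..<n}. x i) / n)"
proof -
  let ?S = "PiM {..<n} (\<lambda>_. borel :: real measure)" and ?U = "PiM {0..1::real} (\<lambda>_. borel :: real measure)"
  obtain P :: "(real \<Rightarrow> real) measure" and W where W: "wiener_process P W"
    and law: "path_law N B = path_law P (\<lambda>s \<omega>. W s \<omega> - s * W 1 \<omega>)"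
    using B unfolding brownian_bridge_def by blast
  define \<tau> where "\<tau> j = real j / real n" for j
  have \<tau>: "\<tau> j \<in> {0..1}" if "j \<le> n" for j using n that by (auto simp: \<tau>_def field_simps)
  have \<tau>Suc: "\<tau> (Suc j) \<in> {0..1}" "\<tau> j \<in> {0..1}" if "j < n" for j using \<tau>[of j] \<tau>[of "Suc j"] that by auto
  define g where "g p = (\<lambda>j\<in>{..<n}. sqrt n * (p (\<tau> (Suc j)) - p (\<tau> j)))" for p :: "real \<Rightarrow> real"
  have g[measurable]: "g \<in> measurable ?U ?S"
    unfolding g_def
    by (intro measurable_restrict borel_measurable_times borel_measurable_const borel_measurable_diff measurable_component_singleton \<tau>Suc) auto
  have Bm: "(\<lambda>\<omega>. \<lambda>t\<in>{0..1}. B t \<omega>) \<in> measurable N ?U"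
    using B by (intro measurable_restrict) (auto simp: brownian_bridge_def)
  have Wm[measurable]: "W t \<in> borel_measurable P" if "t \<in> {0..1}" for t
    using W that by (auto simp: wiener_process_def)
  have W1: "W 1 \<in> borel_measurable P" "W 0 \<in> borel_measurable P" by (auto intro!: Wm)
  have Ym: "(\<lambda>\<omega>. \<lambda>t\<in>{0..1}. W t \<omega> - t * W 1 \<omega>) \<in> measurable P ?U"
    by (intro measurable_restrict borel_measurable_diff borel_measurable_times Wm) auto
  define w where "w \<omega> = (\<lambda>j\<in>{..<n}. sqrt n * (W (\<tau> (Suc j)) \<omega> - W (\<tau> j) \<omega>))" for \<omega>
  define c where "c x = (\<lambda>j\<in>{..<n}. x j - (\<Sum>i\<in>{..<n}. x i) / n)" for x :: "nat \<Rightarrow> real"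
  have w[measurable]: "w \<in> measurable P ?S"
    unfolding w_def by (intro measurable_restrict borel_measurable_times borel_measurable_const borel_measurable_diff Wm \<tau>Suc) auto
  have c[measurable]: "c \<in> measurable ?S ?S" unfolding c_def by measurable
  have "distr N ?S (\<lambda>\<omega>. \<lambda>j\<in>{..<n}. sqrt n * (B (\<tau> (Suc j)) \<omega> - B (\<tau> j) \<omega>)) =
    distr N ?S (g \<circ> (\<lambda>\<omega>. \<lambda>t\<in>{0..1}. B t \<omega>))"
    using \<tau>Suc by (intro distr_cong) (auto simp: g_def fun_eq_iff)
  also have "\<dots> = distr (path_law N B) ?S g"
    unfolding path_law_def by (rule distr_distr[symmetric, OF g Bm])
  also have "\<dots> = distr P ?S (g \<circ> (\<lambda>\<omega>. \<lambda>t\<in>{0..1}. W t \<omega> - t * W 1 \<omega>))"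
    unfolding law unfolding path_law_def by (rule distr_distr[OF g Ym])
  also have "\<dots> = distr P ?S (c \<circ> w)"
  proof (rule distr_cong_AE)
    have "AE \<omega> in P. W 0 \<omega> = 0" using W by (simp add: wiener_process_def)
    thus "AE \<omega> in P. (g \<circ> (\<lambda>\<omega>. \<lambda>t\<in>{0..1}. W t \<omega> - t * W 1 \<omega>)) \<omega> = (c \<circ> w) \<omega>"
    proof eventually_elim
      case (elim \<omega>)
      have "(\<Sum>i<n. w \<omega> i) = sqrt n * (\<Sum>i<n. W (\<tau> (Suc i)) \<omega> - W (\<tau> i) \<omega>)"
        by (simp add: w_def sum_distrib_left)
      also have "(\<Sum>i<n. W (\<tau> (Suc i)) \<omega> - W (\<tau> i) \<omega>) = W (\<tau> n) \<omega> - W (\<tau> 0) \<omega>"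
        by (rule sum_lessThan_telescope)
      also have "\<dots> = W 1 \<omega>" using elim n by (simp add: \<tau>_def)
      finally have s: "(\<Sum>i<n. w \<omega> i) = sqrt n * W 1 \<omega>" .
      have "\<tau> (Suc j) - \<tau> j = 1 / n" for j by (simp add: \<tau>_def add_divide_distrib)
      hence t: "\<tau> (Suc j) * W 1 \<omega> - \<tau> j * W 1 \<omega> = W 1 \<omega> / n" for j
        by (metis left_diff_distrib mult.left_neutral times_divide_eq_left)
      show ?case
      proof
        fix j
        show "(g \<circ> (\<lambda>\<omega>. \<lambda>t\<in>{0..1}. W t \<omega> - t * W 1 \<omega>)) \<omega> j = (c \<circ> w) \<omega> j"
        proof (cases "j < n")
          case True
          hence "(g \<circ> (\<lambda>\<omega>. \<lambda>t\<in>{0..1}. W t \<omega> - t * W 1 \<omega>)) \<omega> j =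
             sqrt n * ((W (\<tau> (Suc j)) \<omega> - W (\<tau> j) \<omega>) - (\<tau> (Suc j) * W 1 \<omega> - \<tau> j * W 1 \<omega>))"
            using \<tau>Suc[OF True] by (simp add: g_def algebra_simps)
          also have "\<dots> = sqrt n * (W (\<tau> (Suc j)) \<omega> - W (\<tau> j) \<omega>) - sqrt n * W 1 \<omega> / n"
            unfolding t by (simp add: right_diff_distrib)
          also have "\<dots> = (c \<circ> w) \<omega> j"
            using True s by (simp add: c_def) (simp add: w_def)
          finally show ?thesis .
        qed (simp add: g_def c_def)
      qed
    qed
  qed (use g Ym w c in \<open>auto intro!: measurable_comp\<close>)
  also have "\<dots> = distr (distr P ?S w) ?S c" by (rule distr_distr[symmetric, OF c w])
  also have "distr P ?S w = PiM {..<n} (\<lambda>_. std_normal)"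
    using wiener_increments_law[OF W n] unfolding w_def \<tau>_def .
  finally show ?thesis unfolding \<tau>_def c_def .
qed

text \<open>The independent drift \<open>t z\<close> restores the mean that the bridge lacks.\<close>

lemma bridge_with_drift_law:
  assumes B: "brownian_bridge N B" and n: "n \<ge> 1"
  shows "distr (N \<Otimes>\<^sub>M std_normal) (PiM {..<n} (\<lambda>_. borel))
     (\<lambda>(\<omega>, z). \<lambda>j\<in>{..<n}. sqrt n * (B (real (Suc j) / n) \<omega> - B (real j / n) \<omega>) + z / sqrt n) = PiM {..<n} (\<lambda>_. std_normal)"
proof -
  let ?S = "PiM {..<n} (\<lambda>_. borel :: real measure)" and ?G = "PiM {..<n} (\<lambda>_. std_normal)"
  interpret N: prob_space N using B by (simp add: brownian_bridge_def)
  interpret Z: prob_space std_normal by (rule prob_space_std_normal)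
  define b where "b \<omega> = (\<lambda>j\<in>{..<n}. sqrt n * (B (real (Suc j) / n) \<omega> - B (real j / n) \<omega>))" for \<omega>
  define c where "c x = (\<lambda>j\<in>{..<n}. x j - (\<Sum>i\<in>{..<n}. x i) / n)" for x :: "nat \<Rightarrow> real"
  define a where "a = (\<lambda>(x, z). \<lambda>j\<in>{..<n}. x j + z / sqrt n :: real)"
  have [measurable]: "B t \<in> borel_measurable N" if "t \<in> {0..1}" for t
    using B that by (auto simp: brownian_bridge_def)
  have b[measurable]: "b \<in> measurable N ?S"
    unfolding b_def
    by (intro measurable_restrict borel_measurable_times borel_measurable_const borel_measurable_diff)
       (use n in \<open>auto simp: field_simps\<close>)
  have sG[measurable_cong]: "sets ?G = sets ?S" by (auto intro!: sets_PiM_cong)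
  have c[measurable]: "c \<in> measurable ?G ?S" unfolding c_def by measurable
  have a[measurable]: "a \<in> measurable (?S \<Otimes>\<^sub>M borel) ?S" unfolding a_def by measurable
  have idl: "distr std_normal borel (\<lambda>z. z) = std_normal" by (simp add: distr_id2)
  have "distr (N \<Otimes>\<^sub>M std_normal) ?S (\<lambda>(\<omega>, z). \<lambda>j\<in>{..<n}. sqrt n * (B (real (Suc j) / n) \<omega> - B (real j / n) \<omega>) + z / sqrt n)
    = distr (N \<Otimes>\<^sub>M std_normal) ?S (a \<circ> (\<lambda>(\<omega>, z). (b \<omega>, z)))"
    by (intro distr_cong) (auto simp: a_def b_def fun_eq_iff)
  also have "\<dots> = distr (distr (N \<Otimes>\<^sub>M std_normal) (?S \<Otimes>\<^sub>M borel) (\<lambda>(\<omega>, z). (b \<omega>, z))) ?S a"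
    by (rule distr_distr[symmetric]) auto
  also have "distr (N \<Otimes>\<^sub>M std_normal) (?S \<Otimes>\<^sub>M borel) (\<lambda>(\<omega>, z). (b \<omega>, z)) = distr N ?S b \<Otimes>\<^sub>M distr std_normal borel (\<lambda>z. z)"
    by (rule pair_measure_distr[symmetric]) (auto simp: idl intro: Z.sigma_finite_measure_axioms)
  also have "distr N ?S b = distr ?G ?S c"
    using bridge_increments_law[OF B n] unfolding b_def c_def .
  also have "distr ?G ?S c \<Otimes>\<^sub>M distr std_normal borel (\<lambda>z. z) = distr (?G \<Otimes>\<^sub>M std_normal) (?S \<Otimes>\<^sub>M borel) (\<lambda>(x, z). (c x, z))"
    by (rule pair_measure_distr) (auto simp: idl intro: Z.sigma_finite_measure_axioms)
  also have "distr \<dots> ?S a = distr (?G \<Otimes>\<^sub>M std_normal) ?S (a \<circ> (\<lambda>(x, z). (c x, z)))"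
    by (rule distr_distr) auto
  also have "\<dots> = distr (?G \<Otimes>\<^sub>M std_normal) ?S (\<lambda>(x, z). \<lambda>j\<in>{..<n}. x j - (\<Sum>i\<in>{..<n}. x i) / n + z / sqrt n)"
    by (intro distr_cong) (auto simp: a_def c_def fun_eq_iff)
  also have "\<dots> = ?G"
    using std_normal_replace_mean[of "{..<n}"] n by (auto simp: lessThan_empty_iff)
  finally show ?thesis .
qed

section \<open>Continuous paths on grids\<close>

definition grid_max :: "(real \<Rightarrow> real) \<Rightarrow> nat \<Rightarrow> real" where
  "grid_max f n = Max ((\<lambda>k. \<bar>f (real k / real n)\<bar>) ` {0..n})"

lemma grid_points_dense:
  assumes "t \<in> {0..1::real}"
  obtains k where "\<And>n. k n \<le> n" "(\<lambda>n. real (k n) / real n) \<longlonglongrightarrow> t"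
proof
  define k where "k n = nat \<lfloor>t * real n\<rfloor>" for n
  show "k n \<le> n" for n
  proof -
    have "t * real n \<le> real n" using assms by (simp add: mult_left_le_one_le)
    thus ?thesis unfolding k_def by linarith
  qed
  have k: "real (k n) \<le> t * real n" "t * real n - 1 \<le> real (k n)" for n
  proof -
    have "0 \<le> t * real n" using assms by simp
    thus "real (k n) \<le> t * real n" "t * real n - 1 \<le> real (k n)" unfolding k_def by linarith+
  qed
  show "(\<lambda>n. real (k n) / real n) \<longlonglongrightarrow> t"
  proof (rule tendsto_sandwich)
    show "\<forall>\<^sub>F n in sequentially. t - 1 / real n \<le> real (k n) / real n"
      using eventually_gt_at_top[of 0]
    proof eventually_elim
      case (elim n)
      have "(t * real n - 1) / real n \<le> real (k n) / real n" by (intro divide_right_mono k) simp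
      with elim show ?case by (simp add: diff_divide_distrib)
    qed
    show "\<forall>\<^sub>F n in sequentially. real (k n) / real n \<le> t"
      using eventually_gt_at_top[of 0]
    proof eventually_elim
      case (elim n)
      thus ?case using k(1)[of n] by (simp add: field_simps)
    qed
    have "(\<lambda>n. t - 1 / real n) \<longlonglongrightarrow> t - 0" by (intro tendsto_intros lim_1_over_n)
    thus "(\<lambda>n. t - 1 / real n) \<longlonglongrightarrow> t" by simp
  qed simp
qed

lemma abs_path_le_SUP:
  fixes f :: "real \<Rightarrow> real"
  assumes "continuous_on {0..1} f" "t \<in> {0..1}"
  shows "\<bar>f t\<bar> \<le> (SUP t\<in>{0..1}. \<bar>f t\<bar>)"
proof (rule cSUP_upper[OF assms(2)])
  have "compact ((\<lambda>t. \<bar>f t\<bar>) ` {0..1})"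
    using assms(1) by (intro compact_continuous_image continuous_intros) auto
  thus "bdd_above ((\<lambda>t. \<bar>f t\<bar>) ` {0..1})" by (intro bounded_imp_bdd_above compact_imp_bounded)
qed

lemma grid_in_unit: "k \<le> n \<Longrightarrow> real k / real n \<in> {0..1}"
  by (auto simp: divide_le_eq)

lemma tendsto_along_grid:
  fixes f :: "real \<Rightarrow> real"
  assumes f: "continuous_on {0..1} f" and t: "t \<in> {0..1}"
    and k: "\<And>n. k n \<le> n" "(\<lambda>n. real (k n) / real n) \<longlonglongrightarrow> t"
  shows "(\<lambda>n. f (real (k n) / real n)) \<longlonglongrightarrow> f t"
  using continuous_on_tendsto_compose[OF f k(2) t] grid_in_unit[OF k(1)] by (auto intro: always_eventually)

lemma grid_max_le_SUP:
  assumes f: "continuous_on {0..1} f"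
  shows "grid_max f n \<le> (SUP t\<in>{0..1}. \<bar>f t\<bar>)"
  unfolding grid_max_def using abs_path_le_SUP[OF f] grid_in_unit by (subst Max_le_iff) auto

lemma grid_max_nonneg: "0 \<le> grid_max f n"
proof -
  have "\<bar>f (real 0 / real n)\<bar> \<le> grid_max f n" unfolding grid_max_def by (intro Max_ge image_eqI[of _ _ 0]) auto
  thus ?thesis by linarith
qed

text \<open>The supremum is attained, and the values at grid points near a maximiser approach it.\<close>

lemma grid_max_tendsto_SUP:
  assumes f: "continuous_on {0..1} f"
  shows "grid_max f \<longlonglongrightarrow> (SUP t\<in>{0..1}. \<bar>f t\<bar>)"
proof -
  have "continuous_on {0..1} (\<lambda>t. \<bar>f t\<bar>)" using f by (intro continuous_intros)
  then obtain t where t: "t \<in> {0..1}" "\<And>s. s \<in> {0..1} \<Longrightarrow> \<bar>f s\<bar> \<le> \<bar>f t\<bar>"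
    using continuous_attains_sup[of "{0..1::real}" "\<lambda>t. \<bar>f t\<bar>"] by auto
  obtain k where k: "\<And>n. k n \<le> n" "(\<lambda>n. real (k n) / real n) \<longlonglongrightarrow> t" using grid_points_dense[OF t(1)] by blast
  have S: "(SUP t\<in>{0..1}. \<bar>f t\<bar>) = \<bar>f t\<bar>"
    using t abs_path_le_SUP[OF f t(1)] by (intro antisym cSUP_least) auto
  show ?thesis
  proof (rule tendsto_sandwich)
    show "(\<lambda>n. \<bar>f (real (k n) / real n)\<bar>) \<longlonglongrightarrow> (SUP t\<in>{0..1}. \<bar>f t\<bar>)"
      unfolding S by (intro tendsto_rabs tendsto_along_grid[OF f t(1) k])
    show "\<forall>\<^sub>F n in sequentially. \<bar>f (real (k n) / real n)\<bar> \<le> grid_max f n"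
      unfolding grid_max_def using k(1) by (intro always_eventually allI Max_ge) auto
    show "\<forall>\<^sub>F n in sequentially. grid_max f n \<le> (SUP t\<in>{0..1}. \<bar>f t\<bar>)"
      using grid_max_le_SUP[OF f] by (intro always_eventually) auto
  qed simp
qed

text \<open>For the weak inequality \<open>\<le>\<close> the grid events converge pointwise to the event for the whole path, also
  at paths whose maximum equals \<open>x\<close>.\<close>

lemma eventually_grid_bound_iff:
  fixes f :: "real \<Rightarrow> real"
  assumes f: "continuous_on {0..1} f"
  shows "\<forall>\<^sub>F n in sequentially. (\<forall>k\<in>{..n}. \<bar>f (real k / real n)\<bar> \<le> x) \<longleftrightarrow> (\<forall>t\<in>{0..1}. \<bar>f t\<bar> \<le> x)"
proof (cases "\<forall>t\<in>{0..1}. \<bar>f t\<bar> \<le> x")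
  case True
  thus ?thesis using grid_in_unit by (intro always_eventually) auto
next
  case False
  then obtain t where t: "t \<in> {0..1}" "x < \<bar>f t\<bar>" by auto
  obtain k where k: "\<And>n. k n \<le> n" "(\<lambda>n. real (k n) / real n) \<longlonglongrightarrow> t" using grid_points_dense[OF t(1)] by blast
  have "(\<lambda>n. \<bar>f (real (k n) / real n)\<bar>) \<longlonglongrightarrow> \<bar>f t\<bar>" by (intro tendsto_rabs tendsto_along_grid[OF f t(1) k])
  hence "\<forall>\<^sub>F n in sequentially. x < \<bar>f (real (k n) / real n)\<bar>" using t(2) by (rule order_tendstoD)
  thus ?thesis
  proof eventually_elim
    case (elim n)
    hence "\<not> (\<forall>k\<in>{..n}. \<bar>f (real k / real n)\<bar> \<le> x)" using k(1)[of n] by (auto intro!: bexI[of _ "k n"] simp: not_le)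
    with False show ?case by blast
  qed
qed

text \<open>The element \<open>0\<close> gives the empty case \<open>n = 0\<close> a value.\<close>

definition max_step :: "(real \<Rightarrow> real) \<Rightarrow> nat \<Rightarrow> real" where
  "max_step f n = Max (insert 0 ((\<lambda>j. \<bar>f (real (Suc j) / real n) - f (real j / real n)\<bar>) ` {..<n}))"

text \<open>Uniform continuity on the compact interval.\<close>

lemma max_step_tendsto_0:
  assumes f: "continuous_on {0..1} f"
  shows "max_step f \<longlonglongrightarrow> 0"
proof (rule LIMSEQ_I)
  fix e :: real assume e: "e > 0"
  have "uniformly_continuous_on {0..1} f" using f by (rule compact_uniformly_continuous) simp
  then obtain d where d: "d > 0" "\<And>s t. s \<in> {0..1} \<Longrightarrow> t \<in> {0..1} \<Longrightarrow> dist t s < d \<Longrightarrow> dist (f t) (f s) < e"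
    using e unfolding uniformly_continuous_on_def by metis
  obtain n0 where n0: "inverse (real (Suc n0)) < d" using reals_Archimedean[OF d(1)] by auto
  show "\<exists>no. \<forall>n\<ge>no. norm (max_step f n - 0) < e"
  proof (intro exI allI impI)
    fix n assume n: "n \<ge> Suc n0"
    have "1 / real n \<le> 1 / real (Suc n0)" using n by (intro divide_left_mono) auto
    hence small: "1 / real n < d" using n0 by (simp add: inverse_eq_divide)
    have "\<bar>f (real (Suc j) / real n) - f (real j / real n)\<bar> < e" if "j < n" for j
    proof -
      have "dist (real (Suc j) / real n) (real j / real n) < d"
        using small by (simp add: dist_real_def add_divide_distrib)
      thus ?thesis using d(2)[OF grid_in_unit grid_in_unit, of j n "Suc j" n] that by (simp add: dist_real_def)
    qed
    hence "max_step f n < e" unfolding max_step_def using e by (subst Max_less_iff) auto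
    moreover have "0 \<le> max_step f n" unfolding max_step_def by (intro Max_ge) auto
    ultimately show "norm (max_step f n - 0) < e" by simp
  qed
qed

lemma max_step_nonneg: "0 \<le> max_step f n"
  unfolding max_step_def by (intro Max_ge) auto

lemma step_le_max_step: "j < n \<Longrightarrow> \<bar>f (real (Suc j) / real n) - f (real j / real n)\<bar> \<le> max_step f n"
  unfolding max_step_def by (intro Max_ge) auto

section \<open>The maximum of the Brownian bridge\<close>

text \<open>Both properties are properties of the path law, and they hold for \<open>W\<^sub>s - s W\<^sub>1\<close>.\<close>

lemma bridge_pinned:
  assumes B: "brownian_bridge N B"
  shows "AE \<omega> in N. B 0 \<omega> = 0 \<and> B 1 \<omega> = 0"
proof -
  let ?U = "PiM {0..1::real} (\<lambda>_. borel :: real measure)"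
  obtain P :: "(real \<Rightarrow> real) measure" and W where W: "wiener_process P W"
    and law: "path_law N B = path_law P (\<lambda>s \<omega>. W s \<omega> - s * W 1 \<omega>)"
    using B unfolding brownian_bridge_def by blast
  have Bm: "(\<lambda>\<omega>. \<lambda>t\<in>{0..1}. B t \<omega>) \<in> measurable N ?U"
    using B by (intro measurable_restrict) (auto simp: brownian_bridge_def)
  have Wm: "W t \<in> borel_measurable P" if "t \<in> {0..1}" for t
    using W that by (auto simp: wiener_process_def)
  have Ym: "(\<lambda>\<omega>. \<lambda>t\<in>{0..1}. W t \<omega> - t * W 1 \<omega>) \<in> measurable P ?U"
    by (intro measurable_restrict borel_measurable_diff borel_measurable_times Wm) auto
  have [measurable]: "(\<lambda>p. p 0) \<in> borel_measurable ?U" "(\<lambda>p. p 1) \<in> borel_measurable ?U"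
    by (auto intro!: measurable_component_singleton)
  have S: "{p \<in> space ?U. p 0 = 0 \<and> p 1 = 0} \<in> sets ?U" by measurable
  have "AE \<omega> in P. W 0 \<omega> = 0" using W by (simp add: wiener_process_def)
  hence "AE p in path_law P (\<lambda>s \<omega>. W s \<omega> - s * W 1 \<omega>). p 0 = 0 \<and> p 1 = 0"
    unfolding path_law_def by (subst AE_distr_iff[OF Ym S]) simp
  thus ?thesis
    unfolding law[symmetric] unfolding path_law_def by (subst (asm) AE_distr_iff[OF Bm S]) simp
qed

lemma max_abs_path_properties:
  assumes B: "brownian_bridge N B"
  shows "max_abs_path B \<in> borel_measurable N"
    and "\<And>\<omega> t. \<omega> \<in> space N \<Longrightarrow> t \<in> {0..1} \<Longrightarrow> \<bar>B t \<omega>\<bar> \<le> max_abs_path B \<omega>"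
    and "\<And>\<omega>. \<omega> \<in> space N \<Longrightarrow> 0 \<le> max_abs_path B \<omega>"
    and "\<And>\<omega>. \<omega> \<in> space N \<Longrightarrow> grid_max (\<lambda>t. B t \<omega>) \<longlonglongrightarrow> max_abs_path B \<omega>"
    and "\<And>\<omega> n. \<omega> \<in> space N \<Longrightarrow> grid_max (\<lambda>t. B t \<omega>) n \<le> max_abs_path B \<omega>"
proof -
  have cont: "continuous_on {0..1} (\<lambda>t. B t \<omega>)" if "\<omega> \<in> space N" for \<omega>
    using B that by (simp add: brownian_bridge_def)
  show lim: "grid_max (\<lambda>t. B t \<omega>) \<longlonglongrightarrow> max_abs_path B \<omega>" if "\<omega> \<in> space N" for \<omega>
    unfolding max_abs_path_def by (rule grid_max_tendsto_SUP[OF cont[OF that]])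
  show "grid_max (\<lambda>t. B t \<omega>) n \<le> max_abs_path B \<omega>" if "\<omega> \<in> space N" for \<omega> n
    unfolding max_abs_path_def by (rule grid_max_le_SUP[OF cont[OF that]])
  show le: "\<bar>B t \<omega>\<bar> \<le> max_abs_path B \<omega>" if "\<omega> \<in> space N" "t \<in> {0..1}" for \<omega> t
    unfolding max_abs_path_def by (rule abs_path_le_SUP[OF cont[OF that(1)] that(2)])
  show "0 \<le> max_abs_path B \<omega>" if "\<omega> \<in> space N" for \<omega>
    using le[OF that, of 0] by simp
  show "max_abs_path B \<in> borel_measurable N"
  proof (rule borel_measurable_LIMSEQ_real)
    show "(\<lambda>n. grid_max (\<lambda>t. B t \<omega>) n) \<longlonglongrightarrow> max_abs_path B \<omega>" if "\<omega> \<in> space N" for \<omega> using lim[OF that] .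
    show "(\<lambda>\<omega>. grid_max (\<lambda>t. B t \<omega>) n) \<in> borel_measurable N" for n
      unfolding grid_max_def
    proof (intro borel_measurable_Max borel_measurable_abs)
      fix k assume "k \<in> {0..n}"
      thus "B (real k / real n) \<in> borel_measurable N"
        using B grid_in_unit[of k n] by (simp add: brownian_bridge_def)
    qed simp
  qed
qed

locale coupled_bridge =
  fixes N :: "'b measure" and B :: "real \<Rightarrow> 'b \<Rightarrow> real"
  assumes bridge: "brownian_bridge N B"
begin

sublocale N: prob_space N using bridge by (simp add: brownian_bridge_def)
sublocale Z: prob_space std_normal by (rule prob_space_std_normal)
sublocale P: pair_prob_space N std_normal ..

abbreviation "X \<equiv> max_abs_path B"
abbreviation "P \<equiv> N \<Otimes>\<^sub>M std_normal"

text \<open>The bridge starts at \<open>0\<close> only almost surely.  Subtracting \<open>B 0\<close> makes the partial sums of the increments of \<open>W\<close>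
  equal to \<open>W\<close> at the grid points for every sample point.\<close>

definition W :: "real \<Rightarrow> 'b \<times> real \<Rightarrow> real" where
  "W t w = B t (fst w) - B 0 (fst w) + t * snd w"

lemma measurable_B: "t \<in> {0..1} \<Longrightarrow> B t \<in> borel_measurable N"
  using bridge by (simp add: brownian_bridge_def)

lemma measurable_W: "t \<in> {0..1} \<Longrightarrow> W t \<in> borel_measurable P"
  unfolding W_def using measurable_B[of t] measurable_B[of 0] by measurable

lemma X_measurable [measurable]: "X \<in> borel_measurable N"
  by (rule max_abs_path_properties[OF bridge])

lemma W_continuous: "w \<in> space P \<Longrightarrow> continuous_on {0..1} (\<lambda>t. W t w)"
  unfolding W_def using bridge by (auto simp: brownian_bridge_def space_pair_measure intro!: continuous_intros)

lemma AE_pinned: "AE w in P. B 0 (fst w) = 0 \<and> B 1 (fst w) = 0"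
proof -
  have "AE \<omega> in distr P N fst. B 0 \<omega> = 0 \<and> B 1 \<omega> = 0"
    unfolding Z.distr_pair_fst by (rule bridge_pinned[OF bridge])
  moreover have "{\<omega> \<in> space N. B 0 \<omega> = 0 \<and> B 1 \<omega> = 0} \<in> sets N"
    using measurable_B[of 0] measurable_B[of 1] by measurable
  ultimately show ?thesis by (subst (asm) AE_distr_iff) auto
qed

lemma expectation_fst_snd:
  fixes f :: "'b \<Rightarrow> real" and g :: "real \<Rightarrow> real"
  assumes [measurable]: "f \<in> borel_measurable N" "g \<in> borel_measurable borel"
    and f: "\<And>\<omega>. \<bar>f \<omega>\<bar> \<le> C" and g: "\<And>z. \<bar>g z\<bar> \<le> D"
  shows "integrable P (\<lambda>w. f (fst w) * g (snd w))"
    and "(\<integral>w. f (fst w) * g (snd w) \<partial>P) = (\<integral>\<omega>. f \<omega> \<partial>N) * (\<integral>z. g z \<partial>std_normal)"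
proof -
  have "0 \<le> C" using f[of undefined] by linarith
  hence "\<bar>f (fst w) * g (snd w)\<bar> \<le> C * D" for w :: "'b \<times> real"
    unfolding abs_mult by (intro mult_mono f g) auto
  thus int: "integrable P (\<lambda>w. f (fst w) * g (snd w))"
    by (intro P.P.integrable_const_bound[where B="C * D"]) auto
  show "(\<integral>w. f (fst w) * g (snd w) \<partial>P) = (\<integral>\<omega>. f \<omega> \<partial>N) * (\<integral>z. g z \<partial>std_normal)"
    using P.integral_fst'[OF int] by simp
qed

definition increment :: "nat \<Rightarrow> nat \<Rightarrow> 'b \<times> real \<Rightarrow> real" where
  "increment n j w = sqrt n * (B (real (Suc j) / n) (fst w) - B (real j / n) (fst w)) + snd w / sqrt n"

lemma increment_altdef:
  assumes "n \<ge> 1"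
  shows "increment n j w = sqrt n * (W (real (Suc j) / n) w - W (real j / n) w)"
proof -
  have "snd w / sqrt n = sqrt n * (snd w / n)"
    using assms by (simp add: field_simps)
  thus ?thesis by (simp add: increment_def W_def algebra_simps add_divide_distrib)
qed

lemma increment_measurable: "j < n \<Longrightarrow> increment n j \<in> borel_measurable P"
  unfolding increment_def
  using measurable_B[OF grid_in_unit, of j n] measurable_B[OF grid_in_unit, of "Suc j" n] by measurable

lemma increments_iid:
  assumes n: "n \<ge> 1"
  shows "P.P.indep_vars (\<lambda>_. borel) (increment n) {..<n}"
    and "\<And>j. j < n \<Longrightarrow> distributed P lborel (increment n j) std_normal_density"
proof -
  have *: "distr P (PiM {..<n} (\<lambda>_. borel)) (\<lambda>w. \<lambda>j\<in>{..<n}. increment n j w) = PiM {..<n} (\<lambda>_. std_normal)"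
    using bridge_with_drift_law[OF bridge n] by (simp add: increment_def split_def)
  note iid = P.P.iid_of_law[OF _ _ prob_space_std_normal _ this]
  show "P.P.indep_vars (\<lambda>_. borel) (increment n) {..<n}"
    using n by (intro iid(1)) (auto intro: increment_measurable simp: lessThan_empty_iff)
  show "distributed P lborel (increment n j) std_normal_density" if "j < n" for j
    using n that by (intro iid(2)[of j]) (auto intro: increment_measurable simp: lessThan_empty_iff)
qed

lemma max_step_W_measurable: "(\<lambda>w. max_step (\<lambda>t. W t w) n) \<in> borel_measurable P"
proof -
  \<comment> \<open>The index \<open>n\<close> stands for the extra element \<open>0\<close>, so that the set becomes the image of a fixed index set.\<close>
  have "(\<lambda>w. Max ((\<lambda>j. if j = n then 0 else \<bar>W (real (Suc j) / n) w - W (real j / n) w\<bar>) ` {..n})) \<in> borel_measurable P"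
  proof (intro borel_measurable_Max)
    fix j assume "j \<in> {..n}"
    thus "(\<lambda>w. if j = n then 0 else \<bar>W (real (Suc j) / n) w - W (real j / n) w\<bar>) \<in> borel_measurable P"
      using measurable_W[OF grid_in_unit, of j n] measurable_W[OF grid_in_unit, of "Suc j" n]
      by (cases "j = n") auto
  qed simp
  also have "(\<lambda>w. Max ((\<lambda>j. if j = n then 0 else \<bar>W (real (Suc j) / n) w - W (real j / n) w\<bar>) ` {..n})) = (\<lambda>w. max_step (\<lambda>t. W t w) n)"
  proof
    fix w
    have "(\<lambda>j. if j = n then 0 else \<bar>W (real (Suc j) / n) w - W (real j / n) w\<bar>) ` {..n} =
       insert 0 ((\<lambda>j. \<bar>W (real (Suc j) / n) w - W (real j / n) w\<bar>) ` {..<n})"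
      unfolding lessThan_Suc_atMost[symmetric] lessThan_Suc image_insert by auto
    thus "Max ((\<lambda>j. if j = n then 0 else \<bar>W (real (Suc j) / n) w - W (real j / n) w\<bar>) ` {..n}) = max_step (\<lambda>t. W t w) n"
      by (simp add: max_step_def)
  qed
  finally show ?thesis .
qed

text \<open>The optional stopping lemma applied to the walk \<open>W (k/n)\<close> and to the sum of images at the remaining time
  \<open>1 - k/n\<close>, increased by \<open>\<eta>\<close> so that the kernels stay Lipschitz up to the end.\<close>

lemma grid_barrier_estimate:
  assumes n: "n \<ge> 1" and x: "x > 0" and \<eta>: "\<eta> > 0"
  shows "\<bar>(\<integral>w. (if \<forall>k\<in>{..n}. \<bar>W (real k / n) w\<bar> \<le> x then images K x \<eta> (W 1 w) else 0) \<partial>P) - images K x (\<eta> + 1) 0\<bar>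
    \<le> (\<integral>w. min ((2 * real K + 1) / sqrt \<eta>) (1 / ((2 * real K + 1) * x) + (2 * real K + 1) / \<eta> * max_step (\<lambda>t. W t w) n) \<partial>P)"
proof -
  define \<xi> where "\<xi> j w = W (real (Suc j) / n) w - W (real j / n) w" for j w
  \<comment> \<open>Truncated subtraction keeps the time at least \<open>\<eta>\<close> for all \<open>k\<close>, as the uniform bound \<open>C\<close> requires.\<close>
  define v where "v k = images K x (\<eta> + real (n - k) / n)" for k
  have S: "(\<Sum>j<k. \<xi> j w) = W (real k / n) w" for k w
    unfolding \<xi>_def by (subst sum_lessThan_telescope) (simp add: W_def)
  have \<xi>: "\<xi> j = (\<lambda>w. 0 + 1 / sqrt n * increment n j w)" for j
    using n by (auto simp: \<xi>_def increment_altdef[OF n])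
  have ind: "P.P.indep_vars (\<lambda>_. borel) \<xi> {..<n}"
    unfolding \<xi> by (rule P.P.indep_vars_compose2[OF increments_iid(1)[OF n]]) measurable
  have dist: "distributed P lborel (\<xi> j) (normal_density 0 (1 / sqrt n))" if "j < n" for j
    unfolding \<xi> using P.P.normal_density_affine[OF increments_iid(2)[OF n that], of "1 / sqrt n" 0] n by simp
  have "\<bar>(\<integral>w. (if \<forall>k\<in>{..n}. \<bar>\<Sum>j<k. \<xi> j w\<bar> \<le> x then v n (\<Sum>j<n. \<xi> j w) else 0) \<partial>P) - v 0 0\<bar>
    \<le> (\<integral>w. min ((2 * real K + 1) / sqrt \<eta>) (1 / ((2 * real K + 1) * x) + (2 * real K + 1) / \<eta> * max_step (\<lambda>t. W t w) n) \<partial>P)"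
  proof (rule P.P.random_walk_barrier[OF ind])
    show "v k \<in> borel_measurable borel" for k unfolding v_def by measurable
    show "\<bar>v k y\<bar> \<le> (2 * real K + 1) / sqrt \<eta>" for k y
      unfolding v_def using \<eta> by (intro images_bound) auto
    show "(\<integral>w. v (Suc k) (y + \<xi> k w) \<partial>P) = v k y" if "k < n" for k y
    proof -
      have "real (n - k) = real (n - Suc k) + 1" using that by simp
      hence e: "real (n - k) / n = real (n - Suc k) / n + 1 / n" by (simp only: add_divide_distrib)
      have tot: "\<eta> + real (n - Suc k) / n + (1 / sqrt n)\<^sup>2 = \<eta> + real (n - k) / n"
        unfolding e using n by (simp add: power_divide)
      have "0 < \<eta> + real (n - Suc k) / n" using \<eta> by (simp add: add_pos_nonneg)
      hence "(\<integral>w. images K x (\<eta> + real (n - Suc k) / n) (y + \<xi> k w) \<partial>P) = images K x (\<eta> + real (n - Suc k) / n + (1 / sqrt n)\<^sup>2) y"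
        using n by (intro P.P.images_expectation[OF dist[OF that]]) auto
      thus ?thesis unfolding v_def tot .
    qed
    show "\<bar>v k y\<bar> \<le> 1 / ((2 * real K + 1) * x) + (2 * real K + 1) / \<eta> * (\<bar>y\<bar> - x)" if "k \<le> n" "x < \<bar>y\<bar>" for k y
      unfolding v_def using \<eta> x that by (intro images_beyond_barrier) auto
    show "(\<lambda>w. max_step (\<lambda>t. W t w) n) \<in> borel_measurable P"
      by (rule max_step_W_measurable)
    show "\<bar>\<xi> j w\<bar> \<le> max_step (\<lambda>t. W t w) n" if "j < n" for j w
      unfolding \<xi>_def using that by (rule step_le_max_step)
  qed (use x \<eta> in \<open>auto simp: max_step_nonneg\<close>)
  moreover have "v n = images K x \<eta>" "v 0 = images K x (\<eta> + 1)" using n by (simp_all add: v_def)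
  moreover have "real n / real n = 1" using n by simp
  ultimately show ?thesis unfolding S by (simp only:)
qed

end

context coupled_bridge begin

text \<open>The limit \<open>n \<rightarrow> \<infinity>\<close>: the largest step of a continuous path tends to \<open>0\<close>, and only the error of the
  truncated sum of images remains.\<close>

lemma barrier_estimate:
  fixes K :: nat
  assumes x: "x > 0" and \<eta>: "\<eta> > 0"
  defines "f \<equiv> \<lambda>w. if \<forall>t\<in>{0..1}. \<bar>W t w\<bar> \<le> x then images K x \<eta> (W 1 w) else 0"
  shows "f \<in> borel_measurable P"
    and "\<bar>(\<integral>w. f w \<partial>P) - images K x (\<eta> + 1) 0\<bar> \<le> 1 / ((2 * real K + 1) * x)"
proof -
  define C where "C = (2 * real K + 1) / sqrt \<eta>"
  define r where "r = 1 / ((2 * real K + 1) * x)"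
  define L where "L = (2 * real K + 1) / \<eta>"
  have CrL: "0 \<le> C" "0 \<le> r" "0 \<le> L" using x \<eta> by (auto simp: C_def r_def L_def)
  define F where "F n w = (if \<forall>k\<in>{..n}. \<bar>W (real k / n) w\<bar> \<le> x then images K x \<eta> (W 1 w) else 0)" for n w
  define G where "G n w = min C (r + L * max_step (\<lambda>t. W t w) n)" for n w
  have W1[measurable]: "W 1 \<in> borel_measurable P" by (rule measurable_W) simp
  have F[measurable]: "F n \<in> borel_measurable P" for n
  proof -
    have [measurable]: "Measurable.pred P (\<lambda>w. \<forall>k\<in>{..n}. \<bar>W (real k / n) w\<bar> \<le> x)"
    proof (intro pred_intros_finite)
      fix k assume "k \<in> {..n}"
      hence [measurable]: "W (real k / n) \<in> borel_measurable P" by (intro measurable_W grid_in_unit) auto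
      show "Measurable.pred P (\<lambda>w. \<bar>W (real k / n) w\<bar> \<le> x)" by measurable
    qed simp
    show ?thesis unfolding F_def by measurable
  qed
  have G[measurable]: "G n \<in> borel_measurable P" for n
    unfolding G_def using max_step_W_measurable[of n] by measurable
  have Flim: "(\<lambda>n. F n w) \<longlonglongrightarrow> f w" if "w \<in> space P" for w
  proof (rule tendsto_eventually)
    show "\<forall>\<^sub>F n in sequentially. F n w = f w"
      using eventually_grid_bound_iff[OF W_continuous[OF that], of x]
      by eventually_elim (simp add: F_def f_def)
  qed
  show f: "f \<in> borel_measurable P"
    by (rule borel_measurable_LIMSEQ_real[OF Flim F])
  have Fb: "\<bar>F n w\<bar> \<le> C" for n w
    using images_bound[OF \<eta> order_refl, of K x "W 1 w"] CrL by (simp add: F_def C_def)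
  have "(\<lambda>n. \<integral>w. F n w \<partial>P) \<longlonglongrightarrow> (\<integral>w. f w \<partial>P)"
    by (rule integral_dominated_convergence[where w="\<lambda>_. C"]) (use f Fb Flim in \<open>auto intro!: AE_I2\<close>)
  hence 1: "(\<lambda>n. \<bar>(\<integral>w. F n w \<partial>P) - images K x (\<eta> + 1) 0\<bar>) \<longlonglongrightarrow> \<bar>(\<integral>w. f w \<partial>P) - images K x (\<eta> + 1) 0\<bar>"
    by (intro tendsto_intros)
  have "(\<lambda>n. G n w) \<longlonglongrightarrow> min C (r + L * 0)" if "w \<in> space P" for w
    unfolding G_def using max_step_tendsto_0[OF W_continuous[OF that]] by (intro tendsto_intros)
  moreover have "\<bar>G n w\<bar> \<le> C" for n w
    using CrL max_step_nonneg[of "\<lambda>t. W t w" n] by (simp add: G_def)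
  ultimately have "(\<lambda>n. \<integral>w. G n w \<partial>P) \<longlonglongrightarrow> (\<integral>w. min C (r + L * 0) \<partial>P)"
    by (intro integral_dominated_convergence[where w="\<lambda>_. C"]) (auto intro!: AE_I2)
  hence 2: "(\<lambda>n. \<integral>w. G n w \<partial>P) \<longlonglongrightarrow> min C r" by (simp add: P.P.prob_space)
  have "\<forall>\<^sub>F n in sequentially. \<bar>(\<integral>w. F n w \<partial>P) - images K x (\<eta> + 1) 0\<bar> \<le> (\<integral>w. G n w \<partial>P)"
    using eventually_ge_at_top[of 1]
  proof eventually_elim
    case (elim n)
    show ?case using grid_barrier_estimate[OF elim x \<eta>, of K] by (simp add: F_def G_def C_def r_def L_def)
  qed
  from tendsto_le[OF _ 2 1 this] show "\<bar>(\<integral>w. f w \<partial>P) - images K x (\<eta> + 1) 0\<bar> \<le> 1 / ((2 * real K + 1) * x)"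
    by (simp add: r_def)
qed

lemma mean_heat_kernel:
  assumes "\<eta> > 0"
  shows "(\<integral>z. heat_kernel \<eta> z \<partial>std_normal) = heat_kernel (\<eta> + 1) 0"
proof -
  have "distributed std_normal lborel (\<lambda>z. z) std_normal_density"
    by (auto simp: distributed_def distr_id2)
  from Z.heat_kernel_expectation[OF this _ assms, of 0] show ?thesis by simp
qed

definition F :: "real \<Rightarrow> real" where
  "F y = measure N {\<omega> \<in> space N. X \<omega> \<le> y}"

lemma expectation_below:
  fixes g :: "real \<Rightarrow> real"
  assumes [measurable]: "g \<in> borel_measurable borel" and g: "\<And>z. \<bar>g z\<bar> \<le> D"
  shows "integrable P (\<lambda>w. (if X (fst w) \<le> y then 1 else 0) * g (snd w))"
    and "(\<integral>w. (if X (fst w) \<le> y then 1 else 0) * g (snd w) \<partial>P) = F y * (\<integral>z. g z \<partial>std_normal)"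
proof -
  have "(\<lambda>\<omega>. if X \<omega> \<le> y then 1 else 0 :: real) \<in> borel_measurable N" by measurable
  note * = expectation_fst_snd[OF this assms(1), of 1 D]
  show "integrable P (\<lambda>w. (if X (fst w) \<le> y then 1 else 0) * g (snd w))"
    using g by (intro *(1)) auto
  have "(\<integral>\<omega>. (if X \<omega> \<le> y then 1 else 0) \<partial>N) = (\<integral>\<omega>. indicator {\<omega> \<in> space N. X \<omega> \<le> y} \<omega> \<partial>N)"
    by (intro Bochner_Integration.integral_cong) auto
  also have "\<dots> = F y" by (simp add: F_def)
  finally show "(\<integral>w. (if X (fst w) \<le> y then 1 else 0) * g (snd w) \<partial>P) = F y * (\<integral>z. g z \<partial>std_normal)"
    using g by (subst *(2)) auto
qed

text \<open>On the event \<open>\<bar>W\<bar> \<le> x\<close> the value at time \<open>1\<close> is \<open>snd w\<close>, with weight close to a heat kernel of variance \<open>\<eta>\<close>.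
  When \<open>\<bar>snd w\<bar> \<le> \<delta>\<close>, the paths of \<open>W\<close> and of the bridge differ by at most \<open>\<delta>\<close>; otherwise the weight is at
  most its value at \<open>\<delta>\<close>.  So the event can be replaced by one for the bridge alone, at the price of moving
  \<open>x\<close> by \<open>\<delta>\<close>, and independence factors the expectation.\<close>

lemma sandwich:
  assumes x: "x > 0" and \<eta>: "\<eta> > 0" and \<delta>: "\<delta> > 0"
  shows "F (x - \<delta>) * (heat_kernel (\<eta> + 1) 0 - heat_kernel \<eta> \<delta>) \<le>
      images K x (\<eta> + 1) 0 + 1 / ((2 * real K + 1) * x) + 2 * real K * heat_kernel \<eta> x" (is ?lower)
    and "images K x (\<eta> + 1) 0 \<le>
      F (x + \<delta>) * heat_kernel (\<eta> + 1) 0 + heat_kernel \<eta> \<delta> + 1 / ((2 * real K + 1) * x) + 2 * real K * heat_kernel \<eta> x" (is ?upper)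
proof -
  define f where "f w = (if \<forall>t\<in>{0..1}. \<bar>W t w\<bar> \<le> x then images K x \<eta> (W 1 w) else 0)" for w
  define e where "e = 2 * real K * heat_kernel \<eta> x"
  have e0: "0 \<le> e" by (simp add: e_def)
  note est = barrier_estimate[OF x \<eta>, of K, folded f_def]
  have near: "\<bar>images K x \<eta> (W 1 w) - heat_kernel \<eta> (W 1 w)\<bar> \<le> e" if "\<forall>t\<in>{0..1}. \<bar>W t w\<bar> \<le> x" for w
    unfolding e_def using that by (intro images_near_origin[OF \<eta>]) auto
  have hk: "\<bar>heat_kernel \<eta> z\<bar> \<le> 1 / sqrt \<eta>" for z using heat_kernel_le[OF \<eta> order_refl, of z] by simp
  have f_int: "integrable P f"
  proof (rule P.P.integrable_const_bound[OF _ est(1)])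
    show "AE w in P. norm (f w) \<le> (2 * real K + 1) / sqrt \<eta>"
      using images_bound[OF \<eta> order_refl, of K x] \<eta> by (auto simp: f_def)
  qed
  have W1: "W 1 w = snd w" if "B 0 (fst w) = 0 \<and> B 1 (fst w) = 0" for w
    using that by (simp add: W_def)
  have BW: "\<bar>\<bar>B t (fst w)\<bar> - \<bar>W t w\<bar>\<bar> \<le> \<bar>snd w\<bar>" if "B 0 (fst w) = 0 \<and> B 1 (fst w) = 0" "t \<in> {0..1}" for t w
  proof -
    have "\<bar>\<bar>B t (fst w)\<bar> - \<bar>W t w\<bar>\<bar> \<le> \<bar>t * snd w\<bar>" using that(1) by (simp add: W_def)
    also have "\<dots> \<le> \<bar>snd w\<bar>" using that(2) by (simp add: abs_mult mult_left_le_one_le)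
    finally show ?thesis .
  qed
  have up: "AE w in P. f w \<le> (if X (fst w) \<le> x + \<delta> then 1 else 0) * heat_kernel \<eta> (snd w) + (heat_kernel \<eta> \<delta> + e)"
    using AE_pinned AE_space
  proof eventually_elim
    case (elim w)
    show ?case
    proof (cases "\<forall>t\<in>{0..1}. \<bar>W t w\<bar> \<le> x")
      case True
      have "f w \<le> heat_kernel \<eta> (snd w) + e" using near[OF True] W1[OF elim(1)] True by (simp add: f_def)
      moreover have "X (fst w) \<le> x + \<delta>" if "\<bar>snd w\<bar> \<le> \<delta>"
        unfolding max_abs_path_def
      proof (rule cSUP_least)
        fix t :: real assume t: "t \<in> {0..1}"
        have "\<bar>W t w\<bar> \<le> x" using True t by blast
        thus "\<bar>B t (fst w)\<bar> \<le> x + \<delta>" using BW[OF elim(1) t] that by linarith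
      qed simp
      moreover have "heat_kernel \<eta> (snd w) \<le> heat_kernel \<eta> \<delta>" if "\<not> \<bar>snd w\<bar> \<le> \<delta>"
        using that \<delta> by (intro heat_kernel_abs_mono[OF \<eta>]) auto
      ultimately have "heat_kernel \<eta> (snd w) \<le> (if X (fst w) \<le> x + \<delta> then 1 else 0) * heat_kernel \<eta> (snd w) + heat_kernel \<eta> \<delta>"
        by (cases "\<bar>snd w\<bar> \<le> \<delta>") (auto intro: add_increasing)
      with \<open>f w \<le> heat_kernel \<eta> (snd w) + e\<close> show ?thesis by linarith
    next
      case False
      hence "f w = 0" unfolding f_def by (rule if_not_P)
      moreover have "0 \<le> (if X (fst w) \<le> x + \<delta> then 1 else 0) * heat_kernel \<eta> (snd w)" by simp
      ultimately show ?thesis using e0 heat_kernel_nonneg[of \<eta> \<delta>] by linarith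
    qed
  qed
  have low: "AE w in P. (if X (fst w) \<le> x - \<delta> then 1 else 0) * (heat_kernel \<eta> (snd w) - heat_kernel \<eta> \<delta>) \<le> f w + e"
    using AE_pinned AE_space
  proof eventually_elim
    case (elim w)
    have f0: "- e \<le> f w"
    proof (cases "\<forall>t\<in>{0..1}. \<bar>W t w\<bar> \<le> x")
      case True
      thus ?thesis using near[OF True] heat_kernel_nonneg[of \<eta> "W 1 w"] unfolding f_def if_P[OF True] by linarith
    next
      case False
      hence "f w = 0" unfolding f_def by (rule if_not_P)
      thus ?thesis using e0 by simp
    qed
    show ?case
    proof (cases "X (fst w) \<le> x - \<delta> \<and> \<bar>snd w\<bar> \<le> \<delta>")
      case True
      have "\<forall>t\<in>{0..1}. \<bar>W t w\<bar> \<le> x"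
      proof
        fix t :: real assume t: "t \<in> {0..1}"
        have "\<bar>B t (fst w)\<bar> \<le> X (fst w)"
          using max_abs_path_properties(2)[OF bridge _ t] elim(2) by (auto simp: space_pair_measure)
        thus "\<bar>W t w\<bar> \<le> x" using BW[OF elim(1) t] True by linarith
      qed
      from near[OF this] this have "heat_kernel \<eta> (W 1 w) \<le> f w + e"
        unfolding f_def by (simp add: abs_le_iff)
      hence "heat_kernel \<eta> (snd w) \<le> f w + e" using W1[OF elim(1)] by simp
      hence "heat_kernel \<eta> (snd w) - heat_kernel \<eta> \<delta> \<le> f w + e"
        using heat_kernel_nonneg[of \<eta> \<delta>] by linarith
      thus ?thesis using True by simp
    next
      case False
      moreover have "heat_kernel \<eta> (snd w) \<le> heat_kernel \<eta> \<delta>" if "\<not> \<bar>snd w\<bar> \<le> \<delta>"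
        using that \<delta> by (intro heat_kernel_abs_mono[OF \<eta>]) auto
      ultimately have "(if X (fst w) \<le> x - \<delta> then 1 else 0) * (heat_kernel \<eta> (snd w) - heat_kernel \<eta> \<delta>) \<le> 0" by auto
      thus ?thesis using f0 by linarith
    qed
  qed
  have hk2: "\<bar>heat_kernel \<eta> z - heat_kernel \<eta> \<delta>\<bar> \<le> 2 / sqrt \<eta>" for z
  proof -
    have "2 / sqrt \<eta> = 1 / sqrt \<eta> + 1 / sqrt \<eta>" by simp
    thus ?thesis using hk[of z] hk[of \<delta>] by linarith
  qed
  note up_int = expectation_below[OF borel_measurable_heat_kernel hk, of "x + \<delta>"]
  have "(\<lambda>z. heat_kernel \<eta> z - heat_kernel \<eta> \<delta>) \<in> borel_measurable borel" by measurable
  note low_int = expectation_below[OF this hk2, of "x - \<delta>"]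
  have "integrable std_normal (heat_kernel \<eta>)"
    by (rule Z.integrable_const_bound[where B="1 / sqrt \<eta>"]) (use hk in auto)
  hence m: "(\<integral>z. heat_kernel \<eta> z - heat_kernel \<eta> \<delta> \<partial>std_normal) = heat_kernel (\<eta> + 1) 0 - heat_kernel \<eta> \<delta>"
    using Z.prob_space by (simp add: mean_heat_kernel[OF \<eta>])
  have "(\<integral>w. f w \<partial>P) \<le> (\<integral>w. (if X (fst w) \<le> x + \<delta> then 1 else 0) * heat_kernel \<eta> (snd w) + (heat_kernel \<eta> \<delta> + e) \<partial>P)"
    by (intro integral_mono_AE f_int Bochner_Integration.integrable_add up_int(1) up) auto
  also have "\<dots> = F (x + \<delta>) * heat_kernel (\<eta> + 1) 0 + (heat_kernel \<eta> \<delta> + e)"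
    using up_int by (simp add: P.P.prob_space mean_heat_kernel[OF \<eta>])
  finally show ?upper using est(2) unfolding e_def by linarith
  have "F (x - \<delta>) * (heat_kernel (\<eta> + 1) 0 - heat_kernel \<eta> \<delta>) =
    (\<integral>w. (if X (fst w) \<le> x - \<delta> then 1 else 0) * (heat_kernel \<eta> (snd w) - heat_kernel \<eta> \<delta>) \<partial>P)"
    by (simp only: low_int(2) m)
  also have "\<dots> \<le> (\<integral>w. f w + e \<partial>P)"
    by (intro integral_mono_AE f_int Bochner_Integration.integrable_add low_int(1) low) auto
  also have "\<dots> = (\<integral>w. f w \<partial>P) + e" using f_int by (simp add: P.P.prob_space)
  finally show ?lower using est(2) unfolding e_def by linarith
qed

text \<open>First \<open>\<eta> \<rightarrow> 0\<close>, which removes the terms with narrow kernels, and then \<open>K \<rightarrow> \<infinity>\<close>.  The order matters: the error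
  \<open>2 K heat_kernel \<eta> x\<close> vanishes only for fixed \<open>K\<close>.\<close>

lemma sandwich_limit:
  assumes x: "x > 0" and \<delta>: "\<delta> > 0"
  defines "G \<equiv> \<lambda>x. 1 + 2 * (\<Sum>k. (-1) ^ Suc k * exp (- 2 * (real (Suc k))\<^sup>2 * x\<^sup>2))"
  shows "F (x - \<delta>) \<le> G x" and "G x \<le> F (x + \<delta>)"
proof -
  define h where "h = heat_kernel 1 0"
  have h: "h > 0" by (simp add: h_def heat_kernel_altdef)
  define \<eta> where "\<eta> i = inverse (real (Suc i))" for i
  have \<eta>: "\<eta> i > 0" for i by (simp add: \<eta>_def)
  have \<eta>0: "\<eta> \<longlonglongrightarrow> 0" unfolding \<eta>_def by (rule LIMSEQ_inverse_real_of_nat)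
  have hk0: "(\<lambda>i. heat_kernel (\<eta> i) c) \<longlonglongrightarrow> 0" if "c > 0" for c
  proof (rule tendsto_sandwich[of "\<lambda>_. 0"])
    have "(\<lambda>i. 2 / c\<^sup>2 * sqrt (\<eta> i)) \<longlonglongrightarrow> 2 / c\<^sup>2 * sqrt 0" by (intro tendsto_intros \<eta>0)
    thus "(\<lambda>i. 2 / c\<^sup>2 * sqrt (\<eta> i)) \<longlonglongrightarrow> 0" by simp
    show "\<forall>\<^sub>F i in sequentially. heat_kernel (\<eta> i) c \<le> 2 / c\<^sup>2 * sqrt (\<eta> i)"
      by (intro always_eventually allI heat_kernel_small_time that \<eta>)
  qed (auto intro!: always_eventually)
  have hk1: "(\<lambda>i. heat_kernel (\<eta> i + 1) c) \<longlonglongrightarrow> heat_kernel 1 c" for c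
  proof -
    have "(\<lambda>i. exp (- c\<^sup>2 / (2 * (\<eta> i + 1))) / sqrt (2 * pi * (\<eta> i + 1))) \<longlonglongrightarrow> exp (- c\<^sup>2 / (2 * (0 + 1))) / sqrt (2 * pi * (0 + 1))"
      by (intro tendsto_intros \<eta>0) auto
    thus ?thesis using \<eta> by (simp add: heat_kernel_altdef add_pos_pos)
  qed
  have im: "(\<lambda>i. images K x (\<eta> i + 1) 0) \<longlonglongrightarrow> images K x 1 0" for K
    unfolding images_def by (intro tendsto_intros hk1)
  have low: "F (x - \<delta>) * h \<le> images K x 1 0 + 1 / ((2 * real K + 1) * x)" for K
  proof -
    have "(\<lambda>i. F (x - \<delta>) * (heat_kernel (\<eta> i + 1) 0 - heat_kernel (\<eta> i) \<delta>)) \<longlonglongrightarrow> F (x - \<delta>) * (heat_kernel 1 0 - 0)"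
      by (intro tendsto_intros hk1 hk0 \<delta>)
    moreover have "(\<lambda>i. images K x (\<eta> i + 1) 0 + 1 / ((2 * real K + 1) * x) + 2 * real K * heat_kernel (\<eta> i) x)
       \<longlonglongrightarrow> images K x 1 0 + 1 / ((2 * real K + 1) * x) + 2 * real K * 0"
      by (intro tendsto_intros im hk0 x)
    ultimately show ?thesis
      using LIMSEQ_le[of _ "F (x - \<delta>) * (heat_kernel 1 0 - 0)" _ "images K x 1 0 + 1 / ((2 * real K + 1) * x) + 2 * real K * 0"]
        sandwich(1)[OF x \<eta> \<delta>, where K=K] by (force simp: h_def)
  qed
  have up: "images K x 1 0 \<le> F (x + \<delta>) * h + 1 / ((2 * real K + 1) * x)" for K
  proof -
    have "(\<lambda>i. F (x + \<delta>) * heat_kernel (\<eta> i + 1) 0 + heat_kernel (\<eta> i) \<delta> + 1 / ((2 * real K + 1) * x) + 2 * real K * heat_kernel (\<eta> i) x)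
       \<longlonglongrightarrow> F (x + \<delta>) * heat_kernel 1 0 + 0 + 1 / ((2 * real K + 1) * x) + 2 * real K * 0"
      by (intro tendsto_intros hk1 hk0 x \<delta>)
    from LIMSEQ_le[OF im[of K] this] show ?thesis
      using sandwich(2)[OF x \<eta> \<delta>, where K=K] by (auto simp: h_def)
  qed
  have quot: "images K x 1 0 / h = 1 + 2 * (\<Sum>k<K. (-1) ^ Suc k * exp (- 2 * (real (Suc k))\<^sup>2 * x\<^sup>2))" for K
  proof -
    have "heat_kernel 1 (2 * real (Suc k) * x) = h * exp (- 2 * (real (Suc k))\<^sup>2 * x\<^sup>2)" for k
      by (simp add: h_def heat_kernel_altdef power_mult_distrib del: of_nat_Suc)
    hence "images K x 1 0 = h * (1 + 2 * (\<Sum>k<K. (-1) ^ Suc k * exp (- 2 * (real (Suc k))\<^sup>2 * x\<^sup>2)))"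
      unfolding images_origin[OF zero_less_one] h_def[symmetric]
      by (simp add: distrib_left sum_distrib_left mult_ac del: of_nat_Suc power_Suc)
    thus ?thesis using h by simp
  qed
  have "(\<lambda>K. \<Sum>k<K. (-1) ^ Suc k * exp (- 2 * (real (Suc k))\<^sup>2 * x\<^sup>2)) \<longlonglongrightarrow> (\<Sum>k. (-1) ^ Suc k * exp (- 2 * (real (Suc k))\<^sup>2 * x\<^sup>2))"
    by (rule summable_LIMSEQ[OF theta_summable[OF x]])
  hence lim: "(\<lambda>K. images K x 1 0 / h) \<longlonglongrightarrow> G x"
    unfolding quot G_def by (intro tendsto_intros)
  have res: "(\<lambda>K. 1 / ((2 * real K + 1) * x) / h) \<longlonglongrightarrow> 0"
  proof (rule tendsto_sandwich[of "\<lambda>_. 0"])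
    have "(\<lambda>K. inverse (real (Suc K)) * (1 / (x * h))) \<longlonglongrightarrow> 0 * (1 / (x * h))"
      by (intro tendsto_intros LIMSEQ_inverse_real_of_nat)
    thus "(\<lambda>K. inverse (real (Suc K)) * (1 / (x * h))) \<longlonglongrightarrow> 0" by simp
    have "1 / ((2 * real K + 1) * x) / h = 1 / (2 * real K + 1) * (1 / (x * h))" for K by simp
    also have "\<dots> K \<le> inverse (real (Suc K)) * (1 / (x * h))" for K
      using x h unfolding inverse_eq_divide by (intro mult_right_mono divide_left_mono) auto
    finally show "\<forall>\<^sub>F K in sequentially. 1 / ((2 * real K + 1) * x) / h \<le> inverse (real (Suc K)) * (1 / (x * h))"
      by (intro always_eventually) auto
  qed (use x h in \<open>auto intro!: always_eventually\<close>)
  show "F (x - \<delta>) \<le> G x"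
  proof (rule LIMSEQ_le_const)
    show "(\<lambda>K. images K x 1 0 / h + 1 / ((2 * real K + 1) * x) / h) \<longlonglongrightarrow> G x"
      using tendsto_add[OF lim res] by simp
    have "F (x - \<delta>) \<le> (images K x 1 0 + 1 / ((2 * real K + 1) * x)) / h" for K
      using low[of K] h by (simp add: pos_le_divide_eq)
    thus "\<exists>n0. \<forall>K\<ge>n0. F (x - \<delta>) \<le> images K x 1 0 / h + 1 / ((2 * real K + 1) * x) / h"
      by (auto simp: add_divide_distrib)
  qed
  show "G x \<le> F (x + \<delta>)"
  proof (rule LIMSEQ_le_const2)
    show "(\<lambda>K. images K x 1 0 / h - 1 / ((2 * real K + 1) * x) / h) \<longlonglongrightarrow> G x"
      using tendsto_diff[OF lim res] by simp
    have "(images K x 1 0 - 1 / ((2 * real K + 1) * x)) / h \<le> F (x + \<delta>)" for K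
      using up[of K] h by (simp add: pos_divide_le_eq)
    thus "\<exists>n0. \<forall>K\<ge>n0. images K x 1 0 / h - 1 / ((2 * real K + 1) * x) / h \<le> F (x + \<delta>)"
      by (auto simp: diff_divide_distrib)
  qed
qed

text \<open>The last limit is \<open>\<delta> \<rightarrow> 0\<close>; the continuity of the series removes the shift of \<open>x\<close> by \<open>\<delta>\<close>.\<close>

lemma kolmogorov_cdf:
  assumes x: "x > 0"
  shows "measure N {\<omega> \<in> space N. X \<omega> \<le> x} = 1 + 2 * (\<Sum>k. (-1) ^ Suc k * exp (- 2 * (real (Suc k))\<^sup>2 * x\<^sup>2))"
proof -
  define G where "G x = 1 + 2 * (\<Sum>k. (-1) ^ Suc k * exp (- 2 * (real (Suc k))\<^sup>2 * x\<^sup>2))" for x :: real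
  have cont: "isCont G x" unfolding G_def[abs_def] by (intro continuous_intros theta_isCont x)
  \<comment> \<open>a sequence of shifts \<open>\<delta>\<close> that tends to \<open>0\<close> and stays in \<open>(0, x)\<close>\<close>
  have s: "(\<lambda>i. x / 2 * inverse (real (Suc i))) \<longlonglongrightarrow> 0"
    using tendsto_mult[OF tendsto_const LIMSEQ_inverse_real_of_nat, of "x / 2"] by simp
  have pos: "0 < x / 2 * inverse (real (Suc i))" "x / 2 * inverse (real (Suc i)) < x" for i
  proof -
    have "inverse (real (Suc i)) \<le> 1" by (simp add: inverse_le_1_iff)
    hence "x / 2 * inverse (real (Suc i)) \<le> x / 2 * 1" using x by (intro mult_left_mono) auto
    thus "x / 2 * inverse (real (Suc i)) < x" using x by simp
  qed (use x in simp)
  have "F x \<le> G x"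
  proof (rule LIMSEQ_le_const)
    show "(\<lambda>i. G (x + x / 2 * inverse (real (Suc i)))) \<longlonglongrightarrow> G x"
      using isCont_tendsto_compose[OF cont tendsto_add[OF tendsto_const s, of x, simplified]] by simp
    have "F x \<le> G (x + x / 2 * inverse (real (Suc i)))" for i
      using sandwich_limit(1)[OF add_pos_pos[OF x pos(1)] pos(1), of i i] by (simp add: G_def)
    thus "\<exists>N. \<forall>i\<ge>N. F x \<le> G (x + x / 2 * inverse (real (Suc i)))" by blast
  qed
  moreover have "G x \<le> F x"
  proof (rule LIMSEQ_le_const2)
    show "(\<lambda>i. G (x - x / 2 * inverse (real (Suc i)))) \<longlonglongrightarrow> G x"
      using isCont_tendsto_compose[OF cont tendsto_diff[OF tendsto_const s, of x, simplified]] by simp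
    have "G (x - x / 2 * inverse (real (Suc i))) \<le> F x" for i
      using sandwich_limit(2)[of "x - x / 2 * inverse (real (Suc i))", OF _ pos(1), of i] pos(2)[of i] by (simp add: G_def)
    thus "\<exists>N. \<forall>i\<ge>N. G (x - x / 2 * inverse (real (Suc i))) \<le> F x" by blast
  qed
  ultimately show ?thesis by (simp add: F_def G_def)
qed

end

section \<open>The scaled maximal INL\<close>

lemma scaled_INL_max_restrict:
  "scaled_INL_max \<sigma> I n \<omega> = scaled_INL_max \<sigma> (\<lambda>j x. x j) n (\<lambda>j\<in>{1..n}. I j \<omega>)"
proof -
  have out: "I_out I k \<omega> = I_out (\<lambda>j x. x j) k (\<lambda>j\<in>{1..n}. I j \<omega>)" if "k \<le> n" for k
    unfolding I_out_def using that by (intro sum.cong) auto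
  have "I_lsb I n \<omega> = I_lsb (\<lambda>j x. x j) n (\<lambda>j\<in>{1..n}. I j \<omega>)"
    unfolding I_lsb_def by (intro arg_cong[where f="\<lambda>s. 1 / real n * s"] sum.cong) auto
  moreover from this out have "INL_max I n \<omega> = INL_max (\<lambda>j x. x j) n (\<lambda>j\<in>{1..n}. I j \<omega>)"
    unfolding INL_max_def INL_def by (intro arg_cong[where f=Max] image_cong) auto
  ultimately show ?thesis by (simp add: scaled_INL_max_def)
qed

lemma borel_measurable_scaled_INL_max:
  "scaled_INL_max \<sigma> (\<lambda>j x. x j) n \<in> borel_measurable (PiM {1..n} (\<lambda>_. borel))"
proof -
  have out: "(\<lambda>x. I_out (\<lambda>j x. x j) k x) \<in> borel_measurable (PiM {1..n} (\<lambda>_. borel))" if "k \<le> n" for k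
    unfolding I_out_def using that by (intro borel_measurable_sum measurable_component_singleton) auto
  have [measurable]: "(\<lambda>x. I_lsb (\<lambda>j x. x j) n x) \<in> borel_measurable (PiM {1..n} (\<lambda>_. borel))"
    using out[of n] unfolding I_lsb_def I_out_def by measurable
  have "(\<lambda>x. INL_max (\<lambda>j x. x j) n x) \<in> borel_measurable (PiM {1..n} (\<lambda>_. borel))"
    unfolding INL_max_def INL_def
  proof (intro borel_measurable_Max borel_measurable_abs)
    fix k assume "k \<in> {0..n}"
    hence [measurable]: "(\<lambda>x. I_out (\<lambda>j x. x j) k x) \<in> borel_measurable (PiM {1..n} (\<lambda>_. borel))" by (intro out) auto
    show "(\<lambda>x. (I_out (\<lambda>j x. x j) k x - real k * I_lsb (\<lambda>j x. x j) n x) / I_lsb (\<lambda>j x. x j) n x) \<in> borel_measurable (PiM {1..n} (\<lambda>_. borel))"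
      by measurable
  qed simp
  thus ?thesis unfolding scaled_INL_max_def by measurable
qed

text \<open>The scaled maximum is a fixed measurable function of the first \<open>n\<close> currents, whose joint law is a product.\<close>

lemma scaled_INL_max_law:
  assumes u: "unit_currents M I \<mu> \<sigma> J" and J: "{1..n} \<subseteq> J" and n: "n \<ge> 1"
  shows "scaled_INL_max \<sigma> I n \<in> borel_measurable M"
    and "distr M borel (scaled_INL_max \<sigma> I n) =
      distr (PiM {1..n} (\<lambda>_. density lborel (normal_density \<mu> \<sigma>))) borel (scaled_INL_max \<sigma> (\<lambda>j x. x j) n)"
proof -
  interpret prob_space M using u by (simp add: unit_currents_def)
  let ?f = "scaled_INL_max \<sigma> (\<lambda>j x. x j) n" and ?R = "\<lambda>\<omega>. \<lambda>j\<in>{1..n}. I j \<omega>" and ?S = "PiM {1..n} (\<lambda>_. borel :: real measure)"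
  have d: "distributed M lborel (I j) (normal_density \<mu> \<sigma>)" if "j \<in> {1..n}" for j
    using u J that by (auto simp: unit_currents_def)
  have R: "?R \<in> measurable M ?S"
    using d by (intro measurable_restrict) (simp add: distributed_def)
  have eq: "scaled_INL_max \<sigma> I n = ?f \<circ> ?R"
    by (rule ext) (simp add: scaled_INL_max_restrict[of \<sigma> I])
  show "scaled_INL_max \<sigma> I n \<in> borel_measurable M"
    unfolding eq by (rule measurable_comp[OF R borel_measurable_scaled_INL_max])
  have "indep_vars (\<lambda>_. borel) I {1..n}"
    using u J by (auto simp: unit_currents_def intro: indep_vars_subset)
  from iid_law[OF this _ d] have law: "distr M ?S ?R = PiM {1..n} (\<lambda>_. density lborel (normal_density \<mu> \<sigma>))"
    using n by simp
  show "distr M borel (scaled_INL_max \<sigma> I n) = distr (PiM {1..n} (\<lambda>_. density lborel (normal_density \<mu> \<sigma>))) borel ?f"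
    unfolding eq law[symmetric] by (rule distr_distr[symmetric, OF borel_measurable_scaled_INL_max R])
qed

context coupled_bridge begin

text \<open>The currents are numbered from \<open>1\<close>, the increments from \<open>0\<close>.\<close>

definition currents :: "real \<Rightarrow> real \<Rightarrow> nat \<Rightarrow> nat \<Rightarrow> 'b \<times> real \<Rightarrow> real" where
  "currents \<mu> \<sigma> n j w = \<mu> + \<sigma> * increment n (j - 1) w"

lemma unit_currents_currents:
  assumes \<sigma>: "\<sigma> > 0" and n: "n \<ge> 1"
  shows "unit_currents P (currents \<mu> \<sigma> n) \<mu> \<sigma> {1..n}"
proof -
  have "P.P.indep_vars (\<lambda>_. borel) (\<lambda>j w. \<mu> + \<sigma> * increment n j w) {..<n}"
    by (rule P.P.indep_vars_compose2[OF increments_iid(1)[OF n]]) measurable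
  hence "P.P.indep_vars (\<lambda>_. borel) (\<lambda>j w. \<mu> + \<sigma> * increment n (j - 1) w) {1..n}"
    by (rule P.P.indep_vars_reindex) (auto simp: inj_on_def)
  moreover have "distributed P lborel (\<lambda>w. \<mu> + \<sigma> * increment n (j - 1) w) (normal_density \<mu> \<sigma>)" if "j \<in> {1..n}" for j
    using P.P.normal_density_affine[OF increments_iid(2)[OF n, of "j - 1"], of \<sigma> \<mu>] that \<sigma> by auto
  ultimately show ?thesis
    unfolding unit_currents_def currents_def[abs_def] using P.P.prob_space_axioms by blast
qed

text \<open>The drift \<open>t Z\<close> of \<open>W\<close> enters \<open>I_out\<close> at \<open>k\<close> and \<open>k\<close> times \<open>I_lsb\<close> alike and cancels, leaving \<open>B\<close> at \<open>k/n\<close>.  The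
  factor \<open>I_lsb\<close> of the scaling cancels the modulus of the denominator up to its sign.\<close>

lemma scaled_INL_max_currents:
  assumes \<sigma>: "\<sigma> > 0" and n: "n \<ge> 1" and w: "B 0 (fst w) = 0" "B 1 (fst w) = 0"
  shows "scaled_INL_max \<sigma> (currents \<mu> \<sigma> n) n w = sgn (\<mu> + \<sigma> * snd w / sqrt n) * grid_max (\<lambda>t. B t (fst w)) n"
proof -
  define c where "c = \<sigma> * sqrt n"
  have c: "c > 0" using \<sigma> n by (simp add: c_def)
  define l where "l = \<mu> + \<sigma> * snd w / sqrt n"
  have out: "I_out (currents \<mu> \<sigma> n) k w = real k * \<mu> + c * W (real k / n) w" for k
  proof -
    have "(\<Sum>j=1..k. currents \<mu> \<sigma> n j w) = (\<Sum>j<k. currents \<mu> \<sigma> n (Suc j) w)"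
      by (rule sum.reindex_bij_witness[of _ Suc "\<lambda>j. j - 1"]) auto
    also have "\<dots> = (\<Sum>j<k. \<mu> + c * (W (real (Suc j) / n) w - W (real j / n) w))"
      by (simp add: currents_def increment_altdef[OF n] c_def mult.assoc)
    also have "\<dots> = real k * \<mu> + c * (\<Sum>j<k. W (real (Suc j) / n) w - W (real j / n) w)"
      by (simp only: sum.distrib sum_distrib_left[symmetric]) simp
    also have "(\<Sum>j<k. W (real (Suc j) / n) w - W (real j / n) w) = W (real k / n) w"
      by (subst sum_lessThan_telescope) (simp add: W_def)
    finally show ?thesis by (simp add: I_out_def)
  qed
  have lsb: "I_lsb (currents \<mu> \<sigma> n) n w = l"
  proof -
    have "I_lsb (currents \<mu> \<sigma> n) n w = (real n * \<mu> + c * snd w) / n"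
      using out[of n] n w by (simp add: I_lsb_def I_out_def W_def)
    moreover have "c * snd w / n = \<sigma> * snd w / sqrt n" using n by (simp add: c_def field_simps)
    hence "(real n * \<mu> + c * snd w) / n = l" using n by (simp add: l_def add_divide_distrib)
    ultimately show ?thesis by simp
  qed
  have "INL (currents \<mu> \<sigma> n) n k w = c * B (real k / n) (fst w) / l" for k
  proof -
    have "c * (real k / n * snd w) = real k * (\<sigma> * snd w / sqrt n)"
      using n by (simp add: c_def field_simps)
    hence "real k * \<mu> + c * W (real k / n) w - real k * l = c * B (real k / n) (fst w)"
      using w by (simp add: l_def W_def distrib_left)
    thus ?thesis by (simp add: INL_def out lsb)
  qed
  hence "INL_max (currents \<mu> \<sigma> n) n w = Max ((\<lambda>y. c / \<bar>l\<bar> * y) ` ((\<lambda>k. \<bar>B (real k / n) (fst w)\<bar>) ` {0..n}))"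
    using c by (simp add: INL_max_def image_image abs_mult)
  also have "\<dots> = c / \<bar>l\<bar> * grid_max (\<lambda>t. B t (fst w)) n"
    unfolding grid_max_def using c by (intro mono_Max_commute[symmetric] monoI mult_left_mono) auto
  finally have "scaled_INL_max \<sigma> (currents \<mu> \<sigma> n) n w = l / c * (c / \<bar>l\<bar> * grid_max (\<lambda>t. B t (fst w)) n)"
    by (simp add: scaled_INL_max_def lsb c_def)
  also have "\<dots> = sgn l * grid_max (\<lambda>t. B t (fst w)) n" using c by (simp add: sgn_real_def)
  finally show ?thesis by (simp add: l_def)
qed

lemma scaled_INL_max_currents_measurable:
  assumes "\<sigma> > 0" "n \<ge> 1"
  shows "scaled_INL_max \<sigma> (currents \<mu> \<sigma> n) n \<in> borel_measurable P"
  by (rule scaled_INL_max_law(1)[OF unit_currents_currents[OF assms] order_refl assms(2)])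

text \<open>For every sample point the sign is eventually \<open>1\<close>, since \<open>\<mu> > 0\<close> and \<open>Z / sqrt n \<rightarrow> 0\<close>.\<close>

lemma scaled_INL_max_currents_AE:
  assumes \<mu>: "\<mu> > 0" and \<sigma>: "\<sigma> > 0"
  shows "AE w in P. (\<lambda>n. scaled_INL_max \<sigma> (currents \<mu> \<sigma> n) n w) \<longlonglongrightarrow> X (fst w)"
    and "n \<ge> 1 \<Longrightarrow> AE w in P. \<bar>scaled_INL_max \<sigma> (currents \<mu> \<sigma> n) n w\<bar> \<le> X (fst w)"
proof -
  show "AE w in P. (\<lambda>n. scaled_INL_max \<sigma> (currents \<mu> \<sigma> n) n w) \<longlonglongrightarrow> X (fst w)"
    using AE_pinned AE_space
  proof eventually_elim
    case (elim w)
    have "(\<lambda>n. \<mu> + \<sigma> * snd w * inverse (sqrt (real n))) \<longlonglongrightarrow> \<mu> + \<sigma> * snd w * 0"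
      by (intro tendsto_intros tendsto_inverse_0_at_top filterlim_compose[OF sqrt_at_top] filterlim_real_sequentially)
    hence "\<forall>\<^sub>F n in sequentially. 0 < \<mu> + \<sigma> * snd w * inverse (sqrt (real n))"
      using \<mu> by (intro order_tendstoD(1)) auto
    hence "\<forall>\<^sub>F n in sequentially. scaled_INL_max \<sigma> (currents \<mu> \<sigma> n) n w = grid_max (\<lambda>t. B t (fst w)) n"
      using eventually_ge_at_top[of 1]
    proof eventually_elim
      case (elim n)
      hence "sgn (\<mu> + \<sigma> * snd w / sqrt n) = 1" by (simp add: divide_inverse)
      thus ?case using scaled_INL_max_currents[OF \<sigma> elim(2)] \<open>B 0 (fst w) = 0 \<and> B 1 (fst w) = 0\<close> by simp
    qed
    moreover have "grid_max (\<lambda>t. B t (fst w)) \<longlonglongrightarrow> X (fst w)"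
      using max_abs_path_properties(4)[OF bridge] elim(2) by (auto simp: space_pair_measure)
    ultimately show ?case by (rule tendsto_cong[THEN iffD2])
  qed
  show "AE w in P. \<bar>scaled_INL_max \<sigma> (currents \<mu> \<sigma> n) n w\<bar> \<le> X (fst w)" if n: "n \<ge> 1"
    using AE_pinned AE_space
  proof eventually_elim
    case (elim w)
    have "\<bar>scaled_INL_max \<sigma> (currents \<mu> \<sigma> n) n w\<bar> \<le> 1 * grid_max (\<lambda>t. B t (fst w)) n"
      using elim(1) by (simp add: scaled_INL_max_currents[OF \<sigma> n] abs_mult abs_sgn_eq grid_max_nonneg)
    also have "\<dots> \<le> X (fst w)"
      using max_abs_path_properties(5)[OF bridge] elim(2) by (auto simp: space_pair_measure)
    finally show ?case .
  qed
qed

lemma tendsto_Lp_currents: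
  assumes \<mu>: "\<mu> > 0" and \<sigma>: "\<sigma> > 0" and p: "p \<ge> 1" and int: "integrable N (\<lambda>\<omega>. X \<omega> ^ p)"
  shows "tendsto_Lp P p (\<lambda>n. scaled_INL_max \<sigma> (currents \<mu> \<sigma> n) n) (\<lambda>w. X (fst w))"
proof -
  define Z where "Z n = scaled_INL_max \<sigma> (currents \<mu> \<sigma> n) n" for n
  have Z[measurable]: "Z n \<in> borel_measurable P" if "n \<ge> 1" for n
    unfolding Z_def by (rule scaled_INL_max_currents_measurable[OF \<sigma> that])
  have bound: "AE w in P. \<bar>Z n w\<bar> \<le> X (fst w)" if "n \<ge> 1" for n
    unfolding Z_def by (rule scaled_INL_max_currents_AE(2)[OF \<mu> \<sigma> that])
  have "integrable (distr P N fst) (\<lambda>\<omega>. X \<omega> ^ p)" using int unfolding Z.distr_pair_fst .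
  hence intP: "integrable P (\<lambda>w. X (fst w) ^ p)" by (subst (asm) integrable_distr_eq) auto
  have X0: "AE w in P. \<bar>X (fst w)\<bar> = X (fst w)"
    using max_abs_path_properties(3)[OF bridge] by (intro AE_I2) (auto simp: space_pair_measure)
  have intabs: "integrable P (\<lambda>w. \<bar>X (fst w)\<bar> ^ p)"
    using intP X0 by (subst integrable_cong_AE[where g="\<lambda>w. X (fst w) ^ p"]) (auto elim: eventually_mono)
  have intZ: "integrable P (\<lambda>w. \<bar>Z n w\<bar> ^ p)" if n: "n \<ge> 1" for n
  proof (rule Bochner_Integration.integrable_bound[OF intP])
    show "AE w in P. norm (\<bar>Z n w\<bar> ^ p) \<le> norm (X (fst w) ^ p)"
      using bound[OF n] by eventually_elim (auto simp: power_abs intro!: power_mono)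
  qed (use Z[OF n] in measurable)
  have "(\<lambda>n. \<integral>w. \<bar>Z (Suc n) w - X (fst w)\<bar> ^ p \<partial>P) \<longlonglongrightarrow> (\<integral>w. 0 \<partial>P)"
  proof (rule integral_dominated_convergence[where w="\<lambda>w. 2 ^ p * X (fst w) ^ p"])
    show "integrable P (\<lambda>w. 2 ^ p * X (fst w) ^ p)" using intP by simp
    show "AE w in P. (\<lambda>n. \<bar>Z (Suc n) w - X (fst w)\<bar> ^ p) \<longlonglongrightarrow> 0"
      using scaled_INL_max_currents_AE(1)[OF \<mu> \<sigma>]
    proof eventually_elim
      case (elim w)
      hence "(\<lambda>n. Z (Suc n) w) \<longlonglongrightarrow> X (fst w)" unfolding Z_def by (rule LIMSEQ_Suc)
      hence "(\<lambda>n. \<bar>Z (Suc n) w - X (fst w)\<bar> ^ p) \<longlonglongrightarrow> \<bar>X (fst w) - X (fst w)\<bar> ^ p" by (intro tendsto_intros)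
      thus ?case using p by (simp add: zero_power)
    qed
    show "AE w in P. norm (\<bar>Z (Suc n) w - X (fst w)\<bar> ^ p) \<le> 2 ^ p * X (fst w) ^ p" for n
      using bound[of "Suc n", simplified] X0
    proof eventually_elim
      case (elim w)
      have "\<bar>Z (Suc n) w - X (fst w)\<bar> ^ p \<le> (2 * X (fst w)) ^ p" using elim by (intro power_mono) auto
      thus ?case by (simp add: power_mult_distrib)
    qed
    show "(\<lambda>w. \<bar>Z (Suc n) w - X (fst w)\<bar> ^ p) \<in> borel_measurable P" for n
      using Z[of "Suc n"] by measurable
  qed simp
  hence "(\<lambda>n. \<integral>w. \<bar>Z (Suc n) w - X (fst w)\<bar> ^ p \<partial>P) \<longlonglongrightarrow> 0" by simp
  hence "(\<lambda>n. \<integral>w. \<bar>Z n w - X (fst w)\<bar> ^ p \<partial>P) \<longlonglongrightarrow> 0" by (rule LIMSEQ_imp_Suc)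
  thus ?thesis unfolding tendsto_Lp_def using intZ Z intabs by (auto simp: Z_def)
qed

text \<open>The laws agree with those of the currents built from the bridge, for which there is almost sure convergence.\<close>

lemma weak_conv_scaled_INL_max:
  assumes \<mu>: "\<mu> > 0" and \<sigma>: "\<sigma> > 0" and u: "unit_currents M I \<mu> \<sigma> {1..}"
  shows "weak_conv_m (\<lambda>n. distr M borel (scaled_INL_max \<sigma> I n)) (distr N borel X)"
proof -
  interpret M: prob_space M using u by (simp add: unit_currents_def)
  have meas: "scaled_INL_max \<sigma> I n \<in> borel_measurable M" for n
  proof (cases "n \<ge> 1")
    case True
    thus ?thesis by (intro scaled_INL_max_law(1)[OF u]) auto
  next
    case False
    hence "scaled_INL_max \<sigma> I n = (\<lambda>_. 0)" by (simp add: scaled_INL_max_def I_lsb_def fun_eq_iff)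
    thus ?thesis by simp
  qed
  show ?thesis
  proof (rule integral_bdd_continuous_conv_imp_weak_conv)
    show "real_distribution (distr M borel (scaled_INL_max \<sigma> I n))" for n
      using meas by (simp add: real_distribution_def real_distribution_axioms_def M.prob_space_distr)
    show "real_distribution (distr N borel X)"
      by (simp add: real_distribution_def real_distribution_axioms_def N.prob_space_distr)
    fix f :: "real \<Rightarrow> real" assume f: "\<And>x. isCont f x" "\<And>x. \<bar>f x\<bar> \<le> 1"
    have [measurable]: "f \<in> borel_measurable borel"
      using f(1) by (intro borel_measurable_continuous_onI continuous_at_imp_continuous_on) auto
    have same: "integral\<^sup>L (distr M borel (scaled_INL_max \<sigma> I (Suc n))) f =
      (\<integral>w. f (scaled_INL_max \<sigma> (currents \<mu> \<sigma> (Suc n)) (Suc n) w) \<partial>P)" for n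
    proof -
      have "distr M borel (scaled_INL_max \<sigma> I (Suc n)) = distr P borel (scaled_INL_max \<sigma> (currents \<mu> \<sigma> (Suc n)) (Suc n))"
        using scaled_INL_max_law(2)[OF u, of "Suc n"]
          scaled_INL_max_law(2)[OF unit_currents_currents[OF \<sigma>, of "Suc n" \<mu>] order_refl] by auto
      thus ?thesis using scaled_INL_max_currents_measurable[OF \<sigma>, of "Suc n" \<mu>] by (simp add: integral_distr)
    qed
    have "(\<lambda>n. \<integral>w. f (scaled_INL_max \<sigma> (currents \<mu> \<sigma> (Suc n)) (Suc n) w) \<partial>P) \<longlonglongrightarrow> (\<integral>w. f (X (fst w)) \<partial>P)"
    proof (rule integral_dominated_convergence[where w="\<lambda>_. 1"])
      show "(\<lambda>w. f (scaled_INL_max \<sigma> (currents \<mu> \<sigma> (Suc n)) (Suc n) w)) \<in> borel_measurable P" for n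
        using scaled_INL_max_currents_measurable[OF \<sigma>, of "Suc n" \<mu>] by measurable
      show "AE w in P. (\<lambda>n. f (scaled_INL_max \<sigma> (currents \<mu> \<sigma> (Suc n)) (Suc n) w)) \<longlonglongrightarrow> f (X (fst w))"
        using scaled_INL_max_currents_AE(1)[OF \<mu> \<sigma>]
      proof eventually_elim
        case (elim w)
        from isCont_tendsto_compose[OF f(1) LIMSEQ_Suc[OF elim]] show ?case .
      qed
    qed (use f(2) in \<open>auto intro!: AE_I2\<close>)
    also have "(\<integral>w. f (X (fst w)) \<partial>P) = integral\<^sup>L (distr N borel X) f"
    proof -
      have "(\<integral>w. f (X (fst w)) \<partial>P) = (\<integral>\<omega>. f (X \<omega>) \<partial>distr P N fst)" by (subst integral_distr) auto
      also have "\<dots> = integral\<^sup>L (distr N borel X) f" unfolding Z.distr_pair_fst by (subst integral_distr) auto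
      finally show ?thesis .
    qed
    finally show "(\<lambda>n. integral\<^sup>L (distr M borel (scaled_INL_max \<sigma> I n)) f) \<longlonglongrightarrow> integral\<^sup>L (distr N borel X) f"
      unfolding same[symmetric] by (subst (asm) filterlim_sequentially_Suc)
  qed
qed

end

theorem theorem2p1:
  fixes M :: "'a measure" and I\<^sub>u :: "nat \<Rightarrow> 'a \<Rightarrow> real" and \<mu> \<sigma> :: real
    and N :: "'b measure" and B :: "real \<Rightarrow> 'b \<Rightarrow> real"
  assumes "\<mu> > 0" and "\<sigma> > 0"
    and "unit_currents M I\<^sub>u \<mu> \<sigma> {1..}"
    and "brownian_bridge N B"
  shows "weak_conv_m (\<lambda>n. distr M borel (scaled_INL_max \<sigma> I\<^sub>u n)) (distr N borel (max_abs_path B))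
    \<and> scaled_INL_max_tendsto_Lp \<mu> \<sigma> {1, 2} N (max_abs_path B)
    \<and> max_abs_path B \<in> borel_measurable N
    \<and> integrable N (\<lambda>\<omega>. (max_abs_path B \<omega>)\<^sup>2)
    \<and> prob_space.expectation N (max_abs_path B) = sqrt (2 * pi) / 2 * ln 2
    \<and> \<bar>sqrt (2 * pi) / 2 * ln 2 - 0.86875\<bar> < 0.00005
    \<and> prob_space.variance N (max_abs_path B) = pi\<^sup>2 / 12 - pi / 2 * (ln 2)\<^sup>2
    \<and> \<bar>pi\<^sup>2 / 12 - pi / 2 * (ln 2)\<^sup>2 - 0.0677732\<bar> < 0.00000005
    \<and> (\<forall>x>0. summable (\<lambda>k. (-1) ^ Suc k * exp (- 2 * (real (Suc k))\<^sup>2 * x\<^sup>2)) \<and>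
         measure N {\<omega> \<in> space N. max_abs_path B \<omega> \<le> x} =
           1 + 2 * (\<Sum>k. (-1) ^ Suc k * exp (- 2 * (real (Suc k))\<^sup>2 * x\<^sup>2)))"
proof -
  interpret coupled_bridge N B by standard fact
  have m: "has_bochner_integral N X (sqrt (2 * pi) / 2 * ln 2)"
    "has_bochner_integral N (\<lambda>\<omega>. (X \<omega>)\<^sup>2) (pi\<^sup>2 / 12)"
    by (rule kolmogorov_moments[OF N.prob_space_axioms X_measurable max_abs_path_properties(3)[OF bridge] kolmogorov_cdf]; assumption)+
  have int: "integrable N X" "integrable N (\<lambda>\<omega>. (X \<omega>)\<^sup>2)" using m by (auto simp: has_bochner_integral_iff)
  have mean: "N.expectation X = sqrt (2 * pi) / 2 * ln 2" using m(1) by (rule has_bochner_integral_integral_eq)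
  have "N.variance X = N.expectation (\<lambda>\<omega>. (X \<omega>)\<^sup>2) - (N.expectation X)\<^sup>2"
    by (rule N.variance_eq[OF int])
  also have "\<dots> = pi\<^sup>2 / 12 - (sqrt (2 * pi) / 2 * ln 2)\<^sup>2"
    by (simp only: mean has_bochner_integral_integral_eq[OF m(2)])
  also have "(sqrt (2 * pi) / 2 * ln 2)\<^sup>2 = pi / 2 * (ln 2)\<^sup>2"
    by (simp add: power_mult_distrib power_divide)
  finally have var: "N.variance X = pi\<^sup>2 / 12 - pi / 2 * (ln 2)\<^sup>2" .
  have Lp: "scaled_INL_max_tendsto_Lp \<mu> \<sigma> {1, 2} N X"
    unfolding scaled_INL_max_tendsto_Lp_def
  proof (intro exI conjI allI impI ballI)
    show "prob_space P" by (rule P.P.prob_space_axioms)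
    show "fst \<in> measurable P N" by simp
    show "distr P N fst = N" by (rule Z.distr_pair_fst)
    show "unit_currents P (currents \<mu> \<sigma> n) \<mu> \<sigma> {1..n}" if "n \<ge> 1" for n
      by (rule unit_currents_currents[OF assms(2) that])
    show "tendsto_Lp P p (\<lambda>n. scaled_INL_max \<sigma> (currents \<mu> \<sigma> n) n) (\<lambda>w. X (fst w))" if "p \<in> {1, 2}" for p
      using that int by (intro tendsto_Lp_currents[OF assms(1,2)]) auto
  qed
  show ?thesis
    using weak_conv_scaled_INL_max[OF assms(1-3)] Lp X_measurable int(2) mean kolmogorov_mean_numeric var
      kolmogorov_variance_numeric theta_summable kolmogorov_cdf by blast
qed

end
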